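(* Let $f:\mathbb{R}^m\times\mathbb{R}^n\to\mathbb{R}$ be twice differentiable and satisfy: (A1) $f$ is $L_0$-Lipschitz for some $L_0$; (A2) $f$ has $L_1$-Lipschitz gradient; (A3) $|f(x,y)|\le 1$ for all $(x,y)$. Let $\lambda_1,\lambda_2>0$. Then the problem $$\min_{p\in\mathcal{P}_2(\mathbb{R}^m)}\ \max_{q\in\mathcal{P}_2(\mathbb{R}^n)}\ \mathbb{E}_{p(x)}\mathbb{E}_{q(y)}[f(x,y)]+\mathcal{R}(p)-\mathcal{R}(q)$$ has a mixed Nash equilibrium $(p_*,q_* )$ which satisfies $$p_*=\arg\min_{p\in\mathcal{P}_2(\mathbb{R}^m)}\ \mathbb{E}_{p(x)}\mathbb{E}_{q_*(y)}[f(x,y)]+\mathcal{R}(p)-\mathcal{R}(q_* ),$$ $$q_*=\arg\max_{q\in\mathcal{P}_2(\mathbb{R}^n)}\ \mathbb{E}_{p_*(x)}\mathbb{E}_{q(y)}[f(x,y)]+\mathcal{R}(p_* )-\mathcal{R}(q).$$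
   Context: $\mathcal{P}_2(\mathbb{R}^k)$ is the set of probability measures on $\mathbb{R}^k$ with finite second moment; probability measures are taken absolutely continuous with respect to Lebesgue measure and identified with their densities. The regularizer is $\mathcal{R}(p)=\mathbb{E}_{p(x)}[\lambda_1\|x\|^2+\lambda_2\log p(x)]$ (and likewise for densities $q$ on $\mathbb{R}^n$). Write $\mathcal{L}(p,q)=\mathbb{E}_{p(x)}\mathbb{E}_{q(y)}[f(x,y)]+\mathcal{R}(p)-\mathcal{R}(q)$. A mixed Nash equilibrium (MNE) is a pair $(p_*,q_* )$ with $\mathcal{L}(p_*,q)\le\mathcal{L}(p_*,q_* )\le\mathcal{L}(p,q_* )$ for all $(p,q)$. *)

theory Defs
  imports "HOL-Probability.Probability"
begin

(* A measure p stands for its density, which is recovered as RN_deriv lborel p. *)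
definition P2 :: "'a::euclidean_space measure set" where
  "P2 = {p. prob_space p \<and> sets p = sets borel \<and> absolutely_continuous lborel p \<and>
            integrable p (\<lambda>x. (norm x)\<^sup>2)}"

(* Expectation of a function whose positive or negative part is integrable; in contrast to
   the Bochner integral, the values PInfty and MInfty are allowed. *)
definition ext_expectation :: "'a measure \<Rightarrow> ('a \<Rightarrow> real) \<Rightarrow> ereal" where
  "ext_expectation p g =
     enn2ereal (\<integral>\<^sup>+ x. ennreal (g x) \<partial>p) - enn2ereal (\<integral>\<^sup>+ x. ennreal (- g x) \<partial>p)"

(* For p in P2 and lam1, lam2 > 0 the negative part of the integrand is p-integrable (compare p with a Gaussian),
   so the value is a real number or PInfty.  The set where the density vanishes is p-null,
   hence the library value of ln at 0 is irrelevant. *)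
definition regularizer :: "real \<Rightarrow> real \<Rightarrow> 'a::euclidean_space measure \<Rightarrow> ereal" where
  "regularizer lam1 lam2 p =
     ext_expectation p (\<lambda>x. lam1 * (norm x)\<^sup>2 + lam2 * ln (enn2real (RN_deriv lborel p x)))"

(* If both regularizers are PInfty, the difference is PInfty by the ereal convention.  This is
   harmless: it only concerns pairs with both regularizers infinite, and neither component
   of an equilibrium can have an infinite regularizer. *)
definition objective ::
  "('a::euclidean_space \<times> 'b::euclidean_space \<Rightarrow> real) \<Rightarrow> real \<Rightarrow> real \<Rightarrow>
   'a measure \<Rightarrow> 'b measure \<Rightarrow> ereal" where
  "objective f lam1 lam2 p q =
     ereal (\<integral>x. (\<integral>y. f (x, y) \<partial>q) \<partial>p) + regularizer lam1 lam2 p - regularizer lam1 lam2 q"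

definition mixed_nash ::
  "('a::euclidean_space \<times> 'b::euclidean_space \<Rightarrow> real) \<Rightarrow> real \<Rightarrow> real \<Rightarrow>
   'a measure \<Rightarrow> 'b measure \<Rightarrow> bool" where
  "mixed_nash f lam1 lam2 ps qs \<longleftrightarrow>
     ps \<in> P2 \<and> qs \<in> P2 \<and>
     (\<forall>p\<in>P2. \<forall>q\<in>P2.
        objective f lam1 lam2 ps q \<le> objective f lam1 lam2 ps qs \<and>
        objective f lam1 lam2 ps qs \<le> objective f lam1 lam2 p qs)"

end

theory Submission
  imports Defs
begin

text \<open>Relative to the Gaussian with density proportional to \<open>exp (- lam1 / lam2 * (norm x)\<^sup>2)\<close>
  on either side, an equilibrium is a pair of densities \<open>a\<close>, \<open>b\<close> such that \<open>lam2 * ln a + \<integral> f b\<close>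
  and \<open>lam2 * ln b - \<integral> f a\<close> are constant. The bilinear part of this system is skew, and the
  logarithm is strongly monotone and Lipschitz between positive bounds \<open>c\<close> and \<open>C\<close>. Hence the explicit step
  \<open>a - eta * (lam2 * ln a + \<integral> f b - mean)\<close>, performed simultaneously with its counterpart for \<open>b\<close>, is an
  \<open>L\<^sup>2\<close> contraction for small \<open>eta\<close>; subtracting the mean preserves the total mass, and the bounds
  \<open>c\<close> and \<open>C\<close> are invariant. Since \<open>t - eta * lam2 * ln t\<close> is itself a contraction on \<open>[c, C]\<close>, the
  iterates even converge pointwise. The inequality \<open>ln t \<le> t - 1\<close>, with equality only at \<open>t = 1\<close>, shows
  that each of the two resulting measures is the unique best response to the other.\<close>

section \<open>The damped best-response step\<close>

text \<open>The bounds are imposed at every point of the space instead of almost everywhere, so that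
  the logarithm, the iteration and its limit can be treated pointwise without exceptional
  sets.\<close>

definition bounded_density :: "'a measure \<Rightarrow> real \<Rightarrow> real \<Rightarrow> ('a \<Rightarrow> real) \<Rightarrow> bool" where
  "bounded_density M c C a \<longleftrightarrow>
     a \<in> borel_measurable M \<and> (\<forall>x\<in>space M. c \<le> a x \<and> a x \<le> C) \<and> (\<integral>x. a x \<partial>M) = 1"

text \<open>This is a gradient step of size \<open>eta\<close> in mean square for the functional
  \<open>\<integral>x. lam * a x * ln (a x) + w x * a x \<partial>M\<close>, projected onto the
  functions of fixed total mass. The additive constant \<open>lam\<close> of the gradient disappears
  together with the mean.\<close>

definition entropic_step :: "'a measure \<Rightarrow> real \<Rightarrow> real \<Rightarrow> ('a \<Rightarrow> real) \<Rightarrow> ('a \<Rightarrow> real) \<Rightarrow> 'a \<Rightarrow> real" where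
  "entropic_step M lam eta w a =
     (\<lambda>x. a x - eta * (lam * ln (a x) + w x - (\<integral>x. lam * ln (a x) + w x \<partial>M)))"

lemma bounded_density_bounds:
  assumes "bounded_density M c C a" "x \<in> space M"
  shows "c \<le> a x" "a x \<le> C"
  using assms unfolding bounded_density_def by auto

lemma bounded_density_measurable [measurable_dest]:
  "bounded_density M c C a \<Longrightarrow> a \<in> borel_measurable M"
  unfolding bounded_density_def by auto

section \<open>The logarithm between positive bounds, and a scalar recursion\<close>

lemma ln_bounded:
  assumes "0 < c" "c \<le> t" "t \<le> (C::real)"
  shows "\<bar>ln t\<bar> \<le> \<bar>ln c\<bar> + \<bar>ln C\<bar>"
proof -
  have "ln c \<le> ln t" "ln t \<le> ln C" using assms by auto
  thus ?thesis by auto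
qed

lemma ln_diff_le:
  assumes "0 < c" "c \<le> s" "c \<le> (t::real)"
  shows "\<bar>ln s - ln t\<bar> \<le> \<bar>s - t\<bar> / c"
proof -
  have *: "ln s - ln t \<le> (s - t) / c" if "t \<le> s" "c \<le> t" for s t :: real
  proof -
    have "ln s - ln t = ln (s / t)" using that assms by (simp add: ln_div)
    also have "\<dots> \<le> s / t - 1" using that assms by (intro ln_le_minus_one) auto
    also have "\<dots> = (s - t) / t" using that assms by (simp add: field_simps)
    also have "\<dots> \<le> (s - t) / c" using that assms by (intro divide_left_mono) auto
    finally show ?thesis .
  qed
  show ?thesis
    using *[of t s] *[of s t] assms ln_mono[of s t] ln_mono[of t s] by (cases "s \<le> t") auto
qed

lemma ln_diff_ge:
  assumes "0 < t" "t \<le> s" "s \<le> (C::real)"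
  shows "(s - t) / C \<le> ln s - ln t"
proof -
  have "(s - t) / C \<le> (s - t) / s" using assms by (intro divide_left_mono) auto
  also have "\<dots> = 1 - t / s" using assms by (simp add: field_simps)
  also have "\<dots> \<le> - ln (t / s)" using ln_le_minus_one[of "t / s"] assms by auto
  also have "\<dots> = ln s - ln t" using assms by (simp add: ln_div)
  finally show ?thesis .
qed

text \<open>Below \<open>C\<close> the logarithm has slope at least \<open>1 / C\<close>. This is
  the source of the contraction in mean square.\<close>

lemma ln_strongly_monotone:
  assumes "0 < s" "0 < t" "s \<le> C" "t \<le> (C::real)"
  shows "(s - t)\<^sup>2 / C \<le> (s - t) * (ln s - ln t)"
proof -
  have *: "(s - t)\<^sup>2 / C \<le> (s - t) * (ln s - ln t)" if "0 < t" "t \<le> s" "s \<le> C" for s t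
    using mult_left_mono[OF ln_diff_ge[OF that], of "s - t"] that by (simp add: power2_eq_square)
  show ?thesis
    using *[of s t] *[of t s] assms by (cases "s \<le> t") (auto simp: algebra_simps power2_eq_square)
qed

text \<open>On \<open>[c, C]\<close> the slope of \<open>s - k * ln s\<close> lies between
  \<open>1 - k / c\<close> and \<open>1 - k / C\<close>. The condition \<open>k \<le> c\<close>
  keeps the lower value nonnegative, so the upper one bounds the absolute difference.\<close>

lemma minus_ln_contraction:
  assumes "0 < c" "0 \<le> k" "k \<le> c" "c \<le> s" "s \<le> C" "c \<le> t" "t \<le> (C::real)"
  shows "\<bar>(s - k * ln s) - (t - k * ln t)\<bar> \<le> (1 - k / C) * \<bar>s - t\<bar>"
proof -
  have *: "\<bar>(s - k * ln s) - (t - k * ln t)\<bar> \<le> (1 - k / C) * \<bar>s - t\<bar>"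
    if "t \<le> s" "c \<le> t" "s \<le> C" for s t
  proof -
    have "k * (ln s - ln t) \<le> k * ((s - t) / c)"
      using ln_diff_le[of c s t] assms that by (intro mult_left_mono) auto
    also have "\<dots> \<le> c * ((s - t) / c)"
      using assms that by (intro mult_right_mono) auto
    finally have 1: "k * (ln s - ln t) \<le> s - t" using assms by simp
    have "k * ((s - t) / C) \<le> k * (ln s - ln t)"
      using ln_diff_ge[of t s C] assms that by (intro mult_left_mono) auto
    with 1 that show ?thesis by (simp add: algebra_simps)
  qed
  show ?thesis
    using *[of s t] *[of t s] assms by (cases "s \<le> t") (auto simp: abs_minus_commute)
qed

text \<open>The perturbation decays more slowly than the contraction, so it dictates the rate: all
  increments are of order \<open>s ^ n\<close>, and the telescoping series of increments converges
  absolutely.\<close>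

lemma perturbed_contraction_convergent:
  fixes a :: "nat \<Rightarrow> real"
  assumes rec: "\<And>n. \<bar>a (Suc (Suc n)) - a (Suc n)\<bar> \<le> r * \<bar>a (Suc n) - a n\<bar> + K * s ^ n"
    and "0 \<le> r" "r < s" "s < 1"
  shows "convergent a"
proof -
  \<comment> \<open>The first entry of the maximum starts the induction. The second gives
    \<open>r * B + K \<le> s * B\<close>, which closes it.\<close>
  define B where "B = max \<bar>a 1 - a 0\<bar> (K / (s - r))"
  have KB: "K \<le> B * (s - r)" using \<open>r < s\<close> by (simp add: B_def le_max_iff_disj flip: pos_divide_le_eq)
  have bound: "\<bar>a (Suc n) - a n\<bar> \<le> B * s ^ n" for n
  proof (induction n)
    case 0 thus ?case by (simp add: B_def)
  next
    case (Suc n)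
    have "K * s ^ n \<le> B * (s - r) * s ^ n" using assms by (intro mult_right_mono KB) auto
    hence "\<bar>a (Suc (Suc n)) - a (Suc n)\<bar> \<le> r * (B * s ^ n) + B * (s - r) * s ^ n"
      using rec[of n] mult_left_mono[OF Suc \<open>0 \<le> r\<close>] by linarith
    thus ?case by (simp add: algebra_simps)
  qed
  have "summable (\<lambda>n. a (Suc n) - a n)"
  proof (rule summable_comparison_test')
    show "summable (\<lambda>n. B * s ^ n)" using assms by (intro summable_mult summable_geometric) auto
  qed (use bound in auto)
  hence "convergent (\<lambda>n. \<Sum>i<n. a (Suc i) - a i)" by (simp add: summable_iff_convergent)
  hence "convergent (\<lambda>n. a n - a 0)" by (simp add: sum_lessThan_telescope)
  hence "convergent (\<lambda>n. (a n - a 0) + a 0)" by (intro convergent_add convergent_const)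
  thus ?thesis by simp
qed

section \<open>Bounded functions and densities on a probability space, and the step acting on
  them\<close>

context prob_space
begin

lemma integrable_bounded:
  assumes "g \<in> borel_measurable M" "\<And>x. x \<in> space M \<Longrightarrow> \<bar>g x\<bar> \<le> (B::real)"
  shows "integrable M g"
  using assms by (intro integrable_const_bound[where B=B]) auto

lemma integral_bounds:
  assumes "integrable M g" "\<And>x. x \<in> space M \<Longrightarrow> \<bar>g x\<bar> \<le> (B::real)"
  shows "\<bar>\<integral>x. g x \<partial>M\<bar> \<le> B"
proof -
  have "\<bar>\<integral>x. g x \<partial>M\<bar> \<le> (\<integral>x. \<bar>g x\<bar> \<partial>M)" by (rule integral_abs_bound)
  also have "\<dots> \<le> (\<integral>x. B \<partial>M)" using assms by (intro integral_mono) auto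
  finally show ?thesis by (simp add: prob_space)
qed

text \<open>The variance of \<open>\<bar>g x\<bar>\<close> is nonnegative; equivalently,
  Cauchy-Schwarz against the constant 1.\<close>

lemma abs_integral_square_le:
  assumes [measurable]: "g \<in> borel_measurable M" and "\<And>x. x \<in> space M \<Longrightarrow> \<bar>g x\<bar> \<le> (B::real)"
  shows "(\<integral>x. \<bar>g x\<bar> \<partial>M)\<^sup>2 \<le> (\<integral>x. (g x)\<^sup>2 \<partial>M)"
proof -
  have i: "integrable M (\<lambda>x. \<bar>g x\<bar>)" using assms by (intro integrable_bounded) auto
  have i2: "integrable M (\<lambda>x. \<bar>g x\<bar>\<^sup>2)"
    by (intro integrable_bounded[of _ "B\<^sup>2"]) (use assms(2) power_mono[OF assms(2), where n=2] in auto)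
  show ?thesis
    using variance_positive[of "\<lambda>x. \<bar>g x\<bar>"] variance_eq[OF i i2] by simp
qed

lemma integrable_bounded_density:
  assumes "bounded_density M c C a" shows "integrable M a"
  using assms by (intro integrable_bounded[of _ "max \<bar>c\<bar> \<bar>C\<bar>"])
    (auto simp: bounded_density_def abs_le_iff le_max_iff_disj)

lemma integrable_ln_density:
  assumes "bounded_density M c C a" "0 < c"
  shows "integrable M (\<lambda>x. ln (a x))"
proof (rule integrable_bounded)
  show "\<bar>ln (a x)\<bar> \<le> \<bar>ln c\<bar> + \<bar>ln C\<bar>" if "x \<in> space M" for x
    using that assms by (intro ln_bounded) (auto simp: bounded_density_def)
qed (use assms in \<open>auto simp: bounded_density_def\<close>)

lemma expectation_ln_le_0:
  assumes "bounded_density M c C a" "0 < c"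
  shows "(\<integral>x. ln (a x) \<partial>M) \<le> 0"
proof -
  have "(\<integral>x. ln (a x) \<partial>M) \<le> (\<integral>x. a x - 1 \<partial>M)"
    using assms integrable_ln_density[OF assms] integrable_bounded_density[OF assms(1)]
      bounded_density_bounds[OF assms(1)]
    by (intro integral_mono ln_le_minus_one) (auto intro: less_le_trans)
  also have "\<dots> = 0"
    using assms integrable_bounded_density[OF assms(1)]
    by (simp add: bounded_density_def prob_space)
  finally show ?thesis .
qed

text \<open>A density bounded by \<open>C\<close> cannot concentrate on small values: it exceeds \<open>1/2\<close> with probability
  at least \<open>1/(2C)\<close>, which keeps the mean of its logarithm well above the logarithm of a tiny lower bound.\<close>

lemma expectation_ln_ge:
  assumes "bounded_density M c C a" "0 < c" "1 \<le> C" "0 \<le> D" "c \<le> exp (- 2 * C * D) / 2"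
  shows "ln c + D \<le> (\<integral>x. ln (a x) \<partial>M)"
proof -
  have "2 * c \<le> exp (- 2 * C * D)" using assms by simp
  hence "ln (2 * c) \<le> - 2 * C * D" using assms ln_le_cancel_iff[of "2 * c" "exp (- 2 * C * D)"] by (simp del: ln_le_cancel_iff)
  hence L: "2 * C * D \<le> - ln (2 * c)" by simp
  \<comment> \<open>An affine minorant of the logarithm along \<open>a\<close>: below
    \<open>1 / 2\<close> the added term is negative and \<open>ln c\<close> suffices, above
    \<open>1 / 2\<close> it is at most \<open>2 * C * D\<close>. As \<open>a\<close> has mass 1, the
    minorant integrates to exactly \<open>ln c + D\<close>.\<close>
  have "ln c + (a x - 1 / 2) * (2 * D) \<le> ln (a x)" if x: "x \<in> space M" for x
  proof (cases "a x \<ge> 1 / 2")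
    case True
    have "(a x - 1 / 2) * (2 * D) \<le> C * (2 * D)"
      using bounded_density_bounds[OF assms(1) x] assms by (intro mult_right_mono) auto
    also have "\<dots> \<le> ln (1 / 2) - ln c" using L assms by (simp add: ln_mult ln_div)
    also have "\<dots> \<le> ln (a x) - ln c" using True by simp
    finally show ?thesis by simp
  next
    case False
    hence "(a x - 1 / 2) * (2 * D) \<le> 0" using assms by (intro mult_nonpos_nonneg) auto
    moreover have "ln c \<le> ln (a x)" using bounded_density_bounds[OF assms(1) x] assms by simp
    ultimately show ?thesis by linarith
  qed
  hence "(\<integral>x. ln c + (a x - 1 / 2) * (2 * D) \<partial>M) \<le> (\<integral>x. ln (a x) \<partial>M)"
    using integrable_ln_density[OF assms(1,2)] integrable_bounded_density[OF assms(1)]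
    by (intro integral_mono) auto
  also have "(\<integral>x. ln c + (a x - 1 / 2) * (2 * D) \<partial>M) = ln c + D"
    using assms integrable_bounded_density[OF assms(1)]
    by (simp add: bounded_density_def prob_space)
  finally show ?thesis .
qed

text \<open>Since \<open>eta * lam \<le> c\<close>, the map \<open>t - eta * lam * ln t\<close> is
  increasing from \<open>c\<close> on, so it suffices to check the step at the two end values. There
  the correction points inwards: the mean \<open>m\<close> exceeds \<open>lam * ln c + w x\<close>
  and stays below \<open>lam * ln C + w x\<close>, possibly with equality.\<close>

lemma bounded_density_step:
  assumes a: "bounded_density M c C a"
    and w [measurable]: "w \<in> borel_measurable M" and w1: "\<And>x. x \<in> space M \<Longrightarrow> \<bar>w x\<bar> \<le> 1"
    and "0 < lam" "0 \<le> eta" "0 < c" "eta * lam \<le> c" and C: "C = exp (2 / lam)"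
    and c: "c \<le> exp (- 4 * C / lam) / 2"
  shows "bounded_density M c C (entropic_step M lam eta w a)"
proof -
  note [measurable] = bounded_density_measurable[OF a]
  define m where "m = (\<integral>x. lam * ln (a x) + w x \<partial>M)"
  have iw: "integrable M w" using w1 by (intro integrable_bounded[of _ 1]) auto
  note ia = integrable_bounded_density[OF a]
  note il = integrable_ln_density[OF a \<open>0 < c\<close>]
  have m_eq: "m = lam * (\<integral>x. ln (a x) \<partial>M) + (\<integral>x. w x \<partial>M)"
    unfolding m_def using iw il by simp
  have iw1: "\<bar>\<integral>x. w x \<partial>M\<bar> \<le> 1" using iw w1 by (rule integral_bounds)
  have "1 \<le> C" using C \<open>0 < lam\<close> by simp
  have "lam * (\<integral>x. ln (a x) \<partial>M) \<le> 0"
    using expectation_ln_le_0[OF a \<open>0 < c\<close>] \<open>0 < lam\<close> by (simp add: mult_le_0_iff)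
  hence m1: "m \<le> 1" using iw1 m_eq by linarith
  \<comment> \<open>Here \<open>D = 2 / lam\<close>, which explains the exponent in the bound on
    \<open>c\<close>. After multiplication by \<open>lam\<close> the margin is 2: one unit absorbs
    the mean of \<open>w\<close>, the other the value of \<open>w\<close> at a point.\<close>
  have "ln c + 2 / lam \<le> (\<integral>x. ln (a x) \<partial>M)"
    by (rule expectation_ln_ge[OF a]) (use assms \<open>1 \<le> C\<close> in auto)
  hence "lam * (ln c + 2 / lam) \<le> lam * (\<integral>x. ln (a x) \<partial>M)"
    using \<open>0 < lam\<close> by (intro mult_left_mono) auto
  hence m2: "lam * ln c + 1 \<le> m" using iw1 m_eq \<open>0 < lam\<close> by (simp add: algebra_simps)
  have step: "entropic_step M lam eta w a x = (a x - eta * lam * ln (a x)) - eta * (w x - m)" for x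
    by (simp add: entropic_step_def m_def algebra_simps)
  have mono: "s - eta * lam * ln s \<le> t - eta * lam * ln t" if "c \<le> s" "s \<le> t" for s t
  proof -
    have "eta * lam * (ln t - ln s) \<le> eta * lam * ((t - s) / c)"
      using ln_diff_le[of c t s] that assms by (intro mult_left_mono) auto
    also have "\<dots> \<le> c * ((t - s) / c)" using that assms by (intro mult_right_mono) auto
    also have "\<dots> = t - s" using \<open>0 < c\<close> by simp
    finally show ?thesis by (simp add: algebra_simps)
  qed
  have "c \<le> entropic_step M lam eta w a x \<and> entropic_step M lam eta w a x \<le> C" if x: "x \<in> space M" for x
  proof
    note b = bounded_density_bounds[OF a x]
    have "0 \<le> eta * (m - lam * ln c - w x)" using w1[OF x] m2 \<open>0 \<le> eta\<close> by (intro mult_nonneg_nonneg) auto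
    hence "c \<le> (c - eta * lam * ln c) - eta * (w x - m)" by (simp add: algebra_simps)
    also have "\<dots> \<le> entropic_step M lam eta w a x" unfolding step using mono[of c "a x"] b by simp
    finally show "c \<le> entropic_step M lam eta w a x" .
    \<comment> \<open>The value of \<open>C\<close> is chosen for this: 2 covers
      \<open>m \<le> 1\<close> together with \<open>- w x \<le> 1\<close>.\<close>
    have "lam * ln C = 2" using C \<open>0 < lam\<close> by simp
    hence "0 \<le> eta * (lam * ln C + w x - m)" using w1[OF x] m1 \<open>0 \<le> eta\<close> by (intro mult_nonneg_nonneg) auto
    hence "(C - eta * lam * ln C) - eta * (w x - m) \<le> C" by (simp add: algebra_simps)
    moreover have "entropic_step M lam eta w a x \<le> (C - eta * lam * ln C) - eta * (w x - m)"
      unfolding step using mono[of "a x" C] b by simp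
    ultimately show "entropic_step M lam eta w a x \<le> C" by simp
  qed
  moreover have "(\<integral>x. entropic_step M lam eta w a x \<partial>M) = 1"
    unfolding entropic_step_def m_def[symmetric] using ia iw il a
    by (simp add: bounded_density_def prob_space m_eq)
  moreover have "entropic_step M lam eta w a \<in> borel_measurable M"
    unfolding entropic_step_def by measurable
  ultimately show ?thesis unfolding bounded_density_def by auto
qed

text \<open>When the square is expanded, the logarithm contributes its monotonicity constant
  \<open>lam / C\<close> to the term linear in \<open>eta\<close> and its Lipschitz constant
  \<open>lam / c\<close> to the quadratic one. The cross term with \<open>w x - w' x\<close> is kept
  exactly instead of being estimated, because it is to cancel against that of the other
  player.\<close>

lemma entropic_step_contraction:
  assumes a: "bounded_density M c C a" and a': "bounded_density M c C a'"
    and w [measurable]: "w \<in> borel_measurable M" and w1: "\<And>x. x \<in> space M \<Longrightarrow> \<bar>w x\<bar> \<le> 1"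
    and w' [measurable]: "w' \<in> borel_measurable M" and w1': "\<And>x. x \<in> space M \<Longrightarrow> \<bar>w' x\<bar> \<le> 1"
    and "0 < lam" "0 \<le> eta" "0 < c"
  shows "(\<integral>x. (entropic_step M lam eta w a x - entropic_step M lam eta w' a' x)\<^sup>2 \<partial>M)
    \<le> (1 - 2 * eta * lam / C + 2 * eta\<^sup>2 * (lam / c)\<^sup>2) * (\<integral>x. (a x - a' x)\<^sup>2 \<partial>M)
      - 2 * eta * (\<integral>x. (a x - a' x) * (w x - w' x) \<partial>M)
      + 2 * eta\<^sup>2 * (\<integral>x. (w x - w' x)\<^sup>2 \<partial>M)"
proof -
  note [measurable] = bounded_density_measurable[OF a] bounded_density_measurable[OF a']
  define d where "d x = a x - a' x" for x
  define e where "e x = w x - w' x" for x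
  define g where "g x = lam * (ln (a x) - ln (a' x)) + e x" for x
  define m where "m = (\<integral>x. g x \<partial>M)"
  have [measurable]: "d \<in> borel_measurable M" "e \<in> borel_measurable M" "g \<in> borel_measurable M"
    unfolding d_def e_def g_def by measurable
  have iw: "integrable M w" "integrable M w'" using w1 w1' by (auto intro!: integrable_bounded[of _ 1])
  note ia = integrable_bounded_density[OF a] integrable_bounded_density[OF a']
  note il = integrable_ln_density[OF a \<open>0 < c\<close>] integrable_ln_density[OF a' \<open>0 < c\<close>]
  have db: "\<bar>d x\<bar> \<le> C" if "x \<in> space M" for x
    using bounded_density_bounds[OF a that] bounded_density_bounds[OF a' that] \<open>0 < c\<close>
    by (auto simp: d_def)
  have eb: "\<bar>e x\<bar> \<le> 2" if "x \<in> space M" for x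
    using w1[OF that] w1'[OF that] by (auto simp: e_def)
  have lnb: "\<bar>lam * (ln (a x) - ln (a' x))\<bar> \<le> lam / c * \<bar>d x\<bar>" if "x \<in> space M" for x
    using mult_left_mono[OF ln_diff_le[of c "a x" "a' x"], of lam] \<open>0 < lam\<close> \<open>0 < c\<close>
      bounded_density_bounds[OF a that] bounded_density_bounds[OF a' that]
    by (auto simp: d_def abs_mult)
  have gb: "\<bar>g x\<bar> \<le> lam / c * C + 2" if "x \<in> space M" for x
  proof -
    have "lam / c * \<bar>d x\<bar> \<le> lam / c * C"
      using db[OF that] \<open>0 < lam\<close> \<open>0 < c\<close> by (intro mult_left_mono) auto
    thus ?thesis using lnb[OF that] eb[OF that] by (auto simp: g_def)
  qed
  have prod_int: "integrable M (\<lambda>x. h x * k x)"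
    if [measurable]: "h \<in> borel_measurable M" "k \<in> borel_measurable M"
      and "\<And>x. x \<in> space M \<Longrightarrow> \<bar>h x\<bar> \<le> A" "\<And>x. x \<in> space M \<Longrightarrow> \<bar>k x\<bar> \<le> B" for h k :: "'a \<Rightarrow> real" and A B
    by (rule integrable_bounded[of _ "A * B"])
       (use that in \<open>auto simp: abs_mult intro!: mult_mono intro: order_trans[OF abs_ge_zero]\<close>)
  have int: "integrable M (\<lambda>x. d x * d x)" "integrable M (\<lambda>x. e x * e x)" "integrable M (\<lambda>x. g x * g x)"
    "integrable M (\<lambda>x. d x * e x)" "integrable M (\<lambda>x. d x * g x)"
    by (rule prod_int[OF _ _ db db], measurable, rule prod_int[OF _ _ eb eb], measurable,
        rule prod_int[OF _ _ gb gb], measurable, rule prod_int[OF _ _ db eb], measurable,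
        rule prod_int[OF _ _ db gb], measurable)
  have int1: "integrable M d" "integrable M e" "integrable M g"
    by (rule integrable_bounded[OF _ db], measurable, rule integrable_bounded[OF _ eb], measurable,
        rule integrable_bounded[OF _ gb], measurable)
  have d0: "(\<integral>x. d x \<partial>M) = 0"
    using a a' ia unfolding d_def by (simp add: bounded_density_def)
  have m: "m = (\<integral>x. lam * ln (a x) + w x \<partial>M) - (\<integral>x. lam * ln (a' x) + w' x \<partial>M)"
    unfolding m_def g_def e_def using iw il by (simp add: algebra_simps)
  have diff: "entropic_step M lam eta w a x - entropic_step M lam eta w' a' x = d x - eta * (g x - m)" for x
    unfolding entropic_step_def m d_def g_def e_def by (simp add: algebra_simps)
  \<comment> \<open>Both densities have mass 1, so \<open>d\<close> has mean 0, while
    \<open>g\<close> has mean \<open>m\<close>. All terms containing \<open>m\<close> therefore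
    collapse to \<open>- eta\<^sup>2 * m\<^sup>2\<close>, which has the favourable sign and is
    dropped below.\<close>
  have "(\<integral>x. (d x - eta * (g x - m))\<^sup>2 \<partial>M)
     = (\<integral>x. d x * d x + eta\<^sup>2 * (g x * g x) - 2 * eta * (d x * g x) + 2 * eta * m * d x
           - 2 * eta\<^sup>2 * m * g x + eta\<^sup>2 * m\<^sup>2 \<partial>M)"
    by (intro Bochner_Integration.integral_cong) (auto simp: algebra_simps power2_eq_square)
  also have "\<dots> = (\<integral>x. d x * d x \<partial>M) + eta\<^sup>2 * (\<integral>x. g x * g x \<partial>M) - 2 * eta * (\<integral>x. d x * g x \<partial>M)
       - eta\<^sup>2 * m\<^sup>2"
    using int int1 d0 by (simp add: prob_space flip: m_def) (simp add: power2_eq_square)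
  also have "\<dots> \<le> (\<integral>x. d x * d x \<partial>M) + eta\<^sup>2 * (2 * (lam / c)\<^sup>2 * (\<integral>x. d x * d x \<partial>M) + 2 * (\<integral>x. e x * e x \<partial>M))
       - 2 * eta * (lam / C * (\<integral>x. d x * d x \<partial>M) + (\<integral>x. d x * e x \<partial>M))"
  proof -
    have "(\<integral>x. g x * g x \<partial>M) \<le> (\<integral>x. 2 * (lam / c)\<^sup>2 * (d x * d x) + 2 * (e x * e x) \<partial>M)"
    proof (rule integral_mono)
      fix x assume x: "x \<in> space M"
      define l where "l = lam * (ln (a x) - ln (a' x))"
      have "\<bar>l\<bar> \<le> \<bar>lam / c * d x\<bar>" using lnb[OF x] \<open>0 < lam\<close> \<open>0 < c\<close> by (simp add: l_def abs_mult)
      hence "l\<^sup>2 \<le> (lam / c * d x)\<^sup>2" by (simp only: abs_le_square_iff)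
      moreover have "(l + e x)\<^sup>2 \<le> 2 * l\<^sup>2 + 2 * (e x)\<^sup>2"
        using zero_le_power2[of "l - e x"] by (simp add: power2_eq_square algebra_simps)
      ultimately show "g x * g x \<le> 2 * (lam / c)\<^sup>2 * (d x * d x) + 2 * (e x * e x)"
        unfolding g_def l_def[symmetric] power2_eq_square[symmetric] power_mult_distrib by simp
    qed (use int in auto)
    also have "\<dots> = 2 * (lam / c)\<^sup>2 * (\<integral>x. d x * d x \<partial>M) + 2 * (\<integral>x. e x * e x \<partial>M)"
      using int by simp
    finally have 1: "eta\<^sup>2 * (\<integral>x. g x * g x \<partial>M) \<le> eta\<^sup>2 * (2 * (lam / c)\<^sup>2 * (\<integral>x. d x * d x \<partial>M) + 2 * (\<integral>x. e x * e x \<partial>M))"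
      by (intro mult_left_mono) auto
    have "lam / C * (\<integral>x. d x * d x \<partial>M) + (\<integral>x. d x * e x \<partial>M) = (\<integral>x. lam / C * (d x * d x) + d x * e x \<partial>M)"
      using int by simp
    also have "\<dots> \<le> (\<integral>x. d x * g x \<partial>M)"
    proof (rule integral_mono)
      fix x assume x: "x \<in> space M"
      have "(d x)\<^sup>2 / C \<le> d x * (ln (a x) - ln (a' x))"
        unfolding d_def using bounded_density_bounds[OF a x] bounded_density_bounds[OF a' x] \<open>0 < c\<close>
        by (intro ln_strongly_monotone) auto
      from mult_left_mono[OF this, of lam]
      show "lam / C * (d x * d x) + d x * e x \<le> d x * g x"
        using \<open>0 < lam\<close> by (simp add: g_def power2_eq_square algebra_simps)
    qed (use int in auto)
    finally have 2: "2 * eta * (lam / C * (\<integral>x. d x * d x \<partial>M) + (\<integral>x. d x * e x \<partial>M)) \<le> 2 * eta * (\<integral>x. d x * g x \<partial>M)"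
      using \<open>0 \<le> eta\<close> by (intro mult_left_mono) auto
    have "0 \<le> eta\<^sup>2 * m\<^sup>2" by simp
    with 1 2 show ?thesis by linarith
  qed
  finally show ?thesis
    unfolding diff unfolding d_def[symmetric] e_def[symmetric] power2_eq_square
    by (simp add: algebra_simps)
qed

section \<open>From decay in mean square to pointwise convergence\<close>

lemma abs_integral_le_sqrt:
  assumes "g \<in> borel_measurable M" "\<And>x. x \<in> space M \<Longrightarrow> \<bar>g x\<bar> \<le> (B::real)"
  shows "(\<integral>x. \<bar>g x\<bar> \<partial>M) \<le> sqrt (\<integral>x. (g x)\<^sup>2 \<partial>M)"
  using abs_integral_square_le[OF assms] by (intro real_le_rsqrt) auto

lemma bounded_density_diff:
  assumes "bounded_density M c C a" "bounded_density M c C a'" "0 < c"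
  shows "(\<lambda>x. a x - a' x) \<in> borel_measurable M" "\<And>x. x \<in> space M \<Longrightarrow> \<bar>a x - a' x\<bar> \<le> C"
  using assms unfolding bounded_density_def by (auto, force simp: abs_le_iff)

text \<open>At a single point the step is a contraction in the value of \<open>a\<close>, up to
  changes of the potential and of the mean. The potential costs \<open>\<delta>\<close>; the mean
  costs \<open>lam / c * \<delta> + \<delta>\<close>, because the mean absolute difference of the
  densities is at most their distance in mean square.\<close>

lemma entropic_step_pointwise:
  assumes a: "bounded_density M c C a" and a': "bounded_density M c C a'"
    and w [measurable]: "w \<in> borel_measurable M" and w1: "\<And>x. x \<in> space M \<Longrightarrow> \<bar>w x\<bar> \<le> 1"
    and w' [measurable]: "w' \<in> borel_measurable M" and w1': "\<And>x. x \<in> space M \<Longrightarrow> \<bar>w' x\<bar> \<le> 1"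
    and "0 < lam" "0 \<le> eta" "0 < c" "eta * lam \<le> c"
    and dw: "\<And>x. x \<in> space M \<Longrightarrow> \<bar>w x - w' x\<bar> \<le> \<delta>"
    and da: "sqrt (\<integral>x. (a x - a' x)\<^sup>2 \<partial>M) \<le> \<delta>"
    and x: "x \<in> space M"
  shows "\<bar>entropic_step M lam eta w a x - entropic_step M lam eta w' a' x\<bar>
    \<le> (1 - eta * lam / C) * \<bar>a x - a' x\<bar> + eta * (2 + lam / c) * \<delta>"
proof -
  note [measurable] = bounded_density_measurable[OF a] bounded_density_measurable[OF a']
  define m where "m = (\<integral>x. lam * ln (a x) + w x \<partial>M)"
  define m' where "m' = (\<integral>x. lam * ln (a' x) + w' x \<partial>M)"
  have iw: "integrable M w" "integrable M w'" using w1 w1' by (auto intro!: integrable_bounded[of _ 1])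
  note il = integrable_ln_density[OF a \<open>0 < c\<close>] integrable_ln_density[OF a' \<open>0 < c\<close>]
  note ia = integrable_bounded_density[OF a] integrable_bounded_density[OF a']
  have "\<bar>m - m'\<bar> = \<bar>\<integral>x. lam * (ln (a x) - ln (a' x)) + (w x - w' x) \<partial>M\<bar>"
    unfolding m_def m'_def using iw il by (simp add: algebra_simps)
  also have "\<dots> \<le> (\<integral>x. \<bar>lam * (ln (a x) - ln (a' x)) + (w x - w' x)\<bar> \<partial>M)"
    by (rule integral_abs_bound)
  also have "\<dots> \<le> (\<integral>x. lam / c * \<bar>a x - a' x\<bar> + \<delta> \<partial>M)"
  proof (rule integral_mono)
    fix x assume x: "x \<in> space M"
    have "\<bar>ln (a x) - ln (a' x)\<bar> \<le> \<bar>a x - a' x\<bar> / c"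
      using \<open>0 < c\<close> bounded_density_bounds[OF a x] bounded_density_bounds[OF a' x] by (intro ln_diff_le) auto
    hence "\<bar>lam * (ln (a x) - ln (a' x))\<bar> \<le> lam / c * \<bar>a x - a' x\<bar>"
      using \<open>0 < lam\<close> mult_left_mono[of "\<bar>ln (a x) - ln (a' x)\<bar>" "\<bar>a x - a' x\<bar> / c" lam]
      by (simp add: abs_mult)
    thus "\<bar>lam * (ln (a x) - ln (a' x)) + (w x - w' x)\<bar> \<le> lam / c * \<bar>a x - a' x\<bar> + \<delta>"
      using dw[OF x] by linarith
  qed (use iw il ia in auto)
  also have "\<dots> = lam / c * (\<integral>x. \<bar>a x - a' x\<bar> \<partial>M) + \<delta>"
    using ia by (simp add: prob_space)
  also have "\<dots> \<le> lam / c * \<delta> + \<delta>"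
    using abs_integral_le_sqrt[OF bounded_density_diff[OF a a' \<open>0 < c\<close>]] da \<open>0 < c\<close> \<open>0 < lam\<close>
    by (intro add_right_mono mult_left_mono) auto
  finally have mm: "\<bar>m - m'\<bar> \<le> lam / c * \<delta> + \<delta>" .
  define A where "A = (a x - eta * lam * ln (a x)) - (a' x - eta * lam * ln (a' x))"
  have A: "\<bar>A\<bar> \<le> (1 - eta * lam / C) * \<bar>a x - a' x\<bar>"
    unfolding A_def
    using bounded_density_bounds[OF a x] bounded_density_bounds[OF a' x] assms
    by (intro minus_ln_contraction) auto
  have "entropic_step M lam eta w a x - entropic_step M lam eta w' a' x
      = A - eta * ((w x - w' x) - (m - m'))"
    unfolding entropic_step_def A_def m_def[symmetric] m'_def[symmetric] by (simp add: algebra_simps)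
  also have "\<bar>\<dots>\<bar> \<le> \<bar>A\<bar> + eta * \<bar>(w x - w' x) - (m - m')\<bar>"
    using \<open>0 \<le> eta\<close> by (auto simp: abs_mult intro: order_trans[OF abs_triangle_ineq4])
  also have "\<dots> \<le> (1 - eta * lam / C) * \<bar>a x - a' x\<bar> + eta * (\<delta> + (lam / c * \<delta> + \<delta>))"
    using A mm dw[OF x] \<open>0 \<le> eta\<close> by (intro add_mono mult_left_mono) auto
  finally show ?thesis by (simp add: algebra_simps)
qed

lemma bounded_convergence:
  assumes "\<And>n. g n \<in> borel_measurable M" "\<And>n x. x \<in> space M \<Longrightarrow> \<bar>g n x\<bar> \<le> (B::real)"
    and "\<And>x. x \<in> space M \<Longrightarrow> (\<lambda>n. g n x) \<longlonglongrightarrow> h x"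
  shows "h \<in> borel_measurable M" "(\<lambda>n. \<integral>x. g n x \<partial>M) \<longlonglongrightarrow> (\<integral>x. h x \<partial>M)"
proof -
  show h: "h \<in> borel_measurable M"
    by (rule borel_measurable_LIMSEQ_metric[of g]) (use assms in auto)
  show "(\<lambda>n. \<integral>x. g n x \<partial>M) \<longlonglongrightarrow> (\<integral>x. h x \<partial>M)"
    by (rule integral_dominated_convergence[where w="\<lambda>_. B"]) (use assms h in auto)
qed

text \<open>Each value \<open>a n x\<close> follows a contraction with geometrically small
  perturbation, and a limit of the iteration is a fixed point of the step. The limit
  \<open>v\<close> of the potentials is left arbitrary: in the application it is the response to the
  limit density of the other player, which is known only after both iterations have been shown to
  converge.\<close>

lemma entropic_iteration_limit:
  assumes a: "\<And>n. bounded_density M c C (a n)"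
    and rec: "\<And>n. a (Suc n) = entropic_step M lam eta (w n) (a n)"
    and w: "\<And>n. w n \<in> borel_measurable M" and w1: "\<And>n x. x \<in> space M \<Longrightarrow> \<bar>w n x\<bar> \<le> 1"
    and "0 < lam" "0 < eta" "0 < c" "eta * lam \<le> c" "c \<le> C"
    and dw: "\<And>n x. x \<in> space M \<Longrightarrow> \<bar>w (Suc n) x - w n x\<bar> \<le> K * s ^ n"
    and da: "\<And>n. sqrt (\<integral>x. (a (Suc n) x - a n x)\<^sup>2 \<partial>M) \<le> K * s ^ n"
    and s: "1 - eta * lam / C < s" "s < 1"
  shows "\<exists>l. bounded_density M c C l \<and> (\<forall>x\<in>space M. (\<lambda>n. a n x) \<longlonglongrightarrow> l x) \<and>
    (\<forall>v. (\<forall>x\<in>space M. (\<lambda>n. w n x) \<longlonglongrightarrow> v x) \<longrightarrow> (\<exists>m. \<forall>x\<in>space M. lam * ln (l x) + v x = m))"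
proof -
  define l where "l x = lim (\<lambda>n. a n x)" for x
  have lim: "(\<lambda>n. a n x) \<longlonglongrightarrow> l x" if x: "x \<in> space M" for x
  proof -
    have "convergent (\<lambda>n. a n x)"
    proof (rule perturbed_contraction_convergent)
      show "\<bar>a (Suc (Suc n)) x - a (Suc n) x\<bar>
          \<le> (1 - eta * lam / C) * \<bar>a (Suc n) x - a n x\<bar> + (eta * (2 + lam / c) * K) * s ^ n" for n
        unfolding rec[of "Suc n"]
        using entropic_step_pointwise[OF a a w w1 w w1 \<open>0 < lam\<close> _ \<open>0 < c\<close> \<open>eta * lam \<le> c\<close> dw da x] \<open>0 < eta\<close>
        by (subst (2) rec) (simp add: mult.assoc)
      have "eta * lam \<le> C" using assms by simp
      thus "0 \<le> 1 - eta * lam / C" using \<open>0 < c\<close> \<open>c \<le> C\<close> by (simp add: field_simps)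
    qed (use s in auto)
    thus ?thesis unfolding l_def by (simp add: convergent_LIMSEQ_iff)
  qed
  note b = bounded_density_bounds[OF a]
  have ab: "\<bar>a n x\<bar> \<le> C" if "x \<in> space M" for n x using b[OF that] \<open>0 < c\<close> by (smt (verit))
  note conv = bounded_convergence[OF bounded_density_measurable[OF a] ab lim]
  have lb: "c \<le> l x" "l x \<le> C" if "x \<in> space M" for x
    using b[OF that] by (auto intro: LIMSEQ_le_const[OF lim[OF that]] LIMSEQ_le_const2[OF lim[OF that]])
  have "(\<integral>x. l x \<partial>M) = 1"
    using LIMSEQ_unique[OF conv(2)] a by (simp add: bounded_density_def)
  hence l: "bounded_density M c C l" using lb conv(1) by (auto simp: bounded_density_def)
  show ?thesis
  proof (intro exI[of _ l] conjI allI impI ballI l lim)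
    fix v assume v: "\<forall>x\<in>space M. (\<lambda>n. w n x) \<longlonglongrightarrow> v x"
    define g where "g n x = lam * ln (a n x) + w n x" for n x
    define h where "h x = lam * ln (l x) + v x" for x
    have gh: "(\<lambda>n. g n x) \<longlonglongrightarrow> h x" if "x \<in> space M" for x
      unfolding g_def h_def using lb[OF that] \<open>0 < c\<close>
      by (intro tendsto_intros lim v[rule_format] that) auto
    have "g n \<in> borel_measurable M" for n
      unfolding g_def using w bounded_density_measurable[OF a] by measurable
    moreover have "\<bar>g n x\<bar> \<le> lam * (\<bar>ln c\<bar> + \<bar>ln C\<bar>) + 1" if "x \<in> space M" for n x
    proof -
      have "\<bar>lam * ln (a n x)\<bar> \<le> lam * (\<bar>ln c\<bar> + \<bar>ln C\<bar>)"
        using ln_bounded[OF \<open>0 < c\<close> b[OF that]] \<open>0 < lam\<close> by (simp add: abs_mult)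
      thus ?thesis unfolding g_def using w1[OF that, of n] by linarith
    qed
    ultimately have m: "(\<lambda>n. \<integral>x. g n x \<partial>M) \<longlonglongrightarrow> (\<integral>x. h x \<partial>M)"
      by (rule bounded_convergence(2)[OF _ _ gh])
    have "h x = (\<integral>x. h x \<partial>M)" if x: "x \<in> space M" for x
    proof -
      \<comment> \<open>Passing to the limit in the recursion shows that the correction vanishes at
        \<open>l\<close>, and \<open>eta\<close> is nonzero.\<close>
      have "(\<lambda>n. a n x - eta * (g n x - (\<integral>x. g n x \<partial>M))) \<longlonglongrightarrow> l x - eta * (h x - (\<integral>x. h x \<partial>M))"
        by (intro tendsto_intros lim gh m x)
      moreover have "(\<lambda>n. a n x - eta * (g n x - (\<integral>x. g n x \<partial>M))) = (\<lambda>n. a (Suc n) x)"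
        by (simp add: rec entropic_step_def g_def)
      ultimately have "(\<lambda>n. a (Suc n) x) \<longlonglongrightarrow> l x - eta * (h x - (\<integral>x. h x \<partial>M))" by metis
      moreover have "(\<lambda>n. a (Suc n) x) \<longlonglongrightarrow> l x"
        using LIMSEQ_ignore_initial_segment[OF lim[OF x], of 1] by simp
      ultimately have "l x - eta * (h x - (\<integral>x. h x \<partial>M)) = l x"
        by (rule LIMSEQ_unique)
      thus ?thesis using \<open>0 < eta\<close> by simp
    qed
    thus "\<exists>m. \<forall>x\<in>space M. lam * ln (l x) + v x = m" unfolding h_def by blast
  qed
qed

end

section \<open>Entropic equilibria of bounded games\<close>

locale bounded_game = M: prob_space M + N: prob_space N for M :: "'a measure" and N :: "'b measure" +
  fixes f :: "'a \<times> 'b \<Rightarrow> real"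
  assumes f_measurable [measurable]: "f \<in> borel_measurable (M \<Otimes>\<^sub>M N)"
    and f_bounded: "\<bar>f (x, y)\<bar> \<le> 1"
begin

section \<open>The payoff as an operator on the opponent's densities\<close>

definition response :: "('b \<Rightarrow> real) \<Rightarrow> 'a \<Rightarrow> real" where
  "response b x = (\<integral>y. f (x, y) * b y \<partial>N)"

lemma response_measurable:
  assumes [measurable]: "b \<in> borel_measurable N"
  shows "response b \<in> borel_measurable M"
  unfolding response_def by measurable

lemma response_integrable:
  assumes "integrable N b" "x \<in> space M"
  shows "integrable N (\<lambda>y. f (x, y) * b y)"
proof (rule Bochner_Integration.integrable_bound[OF assms(1)])
  show "AE y in N. norm (f (x, y) * b y) \<le> norm (b y)"
    using f_bounded by (intro AE_I2) (auto simp: abs_mult mult_left_le_one_le)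
qed (use assms in measurable)

lemma response_diff:
  assumes "integrable N b" "integrable N b'" "x \<in> space M"
  shows "\<bar>response b x - response b' x\<bar> \<le> (\<integral>y. \<bar>b y - b' y\<bar> \<partial>N)"
proof -
  have "response b x - response b' x = (\<integral>y. f (x, y) * (b y - b' y) \<partial>N)"
    using response_integrable[OF _ assms(3)] assms by (simp add: response_def algebra_simps)
  also have "\<bar>\<dots>\<bar> \<le> (\<integral>y. \<bar>f (x, y) * (b y - b' y)\<bar> \<partial>N)" by (rule integral_abs_bound)
  also have "\<dots> \<le> (\<integral>y. \<bar>b y - b' y\<bar> \<partial>N)"
  proof (rule integral_mono)
    show "integrable N (\<lambda>y. \<bar>f (x, y) * (b y - b' y)\<bar>)"
      using assms by (intro integrable_abs response_integrable) auto
  qed (use assms f_bounded in \<open>auto simp: abs_mult mult_left_le_one_le\<close>)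
  finally show ?thesis .
qed

lemma response_bounded:
  assumes b: "bounded_density N c C b" and "0 < c" "x \<in> space M"
  shows "\<bar>response b x\<bar> \<le> 1"
proof -
  have "(\<integral>y. \<bar>b y\<bar> \<partial>N) = (\<integral>y. b y \<partial>N)"
    using bounded_density_bounds[OF b] \<open>0 < c\<close>
    by (intro Bochner_Integration.integral_cong) (auto intro: abs_of_nonneg order_trans[OF less_imp_le])
  moreover have "response (\<lambda>_. 0) x = 0" by (simp add: response_def)
  ultimately show ?thesis
    using response_diff[OF N.integrable_bounded_density[OF b] _ assms(3), of "\<lambda>_. 0"] b
    by (simp add: bounded_density_def)
qed

lemma response_diff_sqrt:
  assumes b: "bounded_density N c C b" and b': "bounded_density N c C b'" and "0 < c" "x \<in> space M"
  shows "\<bar>response b x - response b' x\<bar> \<le> sqrt (\<integral>y. (b y - b' y)\<^sup>2 \<partial>N)"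
  using response_diff[OF N.integrable_bounded_density[OF b] N.integrable_bounded_density[OF b'] assms(4)]
    N.abs_integral_le_sqrt[OF N.bounded_density_diff[OF b b' \<open>0 < c\<close>]] by linarith

text \<open>The pointwise bound does not depend on \<open>x\<close>, and averaging it over the
  probability measure \<open>M\<close> preserves it. Thus the response operator does not expand
  distances in mean square.\<close>

lemma response_diff_energy:
  assumes b: "bounded_density N c C b" and b': "bounded_density N c C b'" and "0 < c"
  shows "(\<integral>x. (response b x - response b' x)\<^sup>2 \<partial>M) \<le> (\<integral>y. (b y - b' y)\<^sup>2 \<partial>N)"
proof -
  let ?S = "\<integral>y. (b y - b' y)\<^sup>2 \<partial>N"
  have sq: "(response b x - response b' x)\<^sup>2 \<le> ?S" if "x \<in> space M" for x
    using power_mono[OF response_diff_sqrt[OF b b' \<open>0 < c\<close> that], of 2] by simp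
  have [measurable]: "response b \<in> borel_measurable M" "response b' \<in> borel_measurable M"
    using b b' by (auto intro: response_measurable bounded_density_measurable)
  have "\<bar>\<integral>x. (response b x - response b' x)\<^sup>2 \<partial>M\<bar> \<le> ?S"
    using sq by (intro M.integral_bounds M.integrable_bounded[of _ ?S]) auto
  thus ?thesis by linarith
qed

text \<open>The second player maximises, hence plays the role of the first player in the transposed
  game with the opposite sign. Every estimate on responses is thereby available for both
  players.\<close>

lemma opponent_game: "bounded_game N M (\<lambda>(y, x). - f (x, y))"
proof
  show "(\<lambda>(y, x). - f (x, y)) \<in> borel_measurable (N \<Otimes>\<^sub>M M)" by measurable
qed (use f_bounded in auto)

lemma response_minus:
  assumes "integrable N b" "integrable N b'" "x \<in> space M"
  shows "response (\<lambda>y. b y - b' y) x = response b x - response b' x"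
  using response_integrable[OF _ assms(3)] assms by (simp add: response_def algebra_simps)

interpretation opponent: bounded_game N M "\<lambda>(y, x). - f (x, y)"
  by (rule opponent_game)

text \<open>Fubini, with the sign coming from the negated payoff of the opponent. It removes the
  coupling of the players from the sum of their energies, however strong the coupling is relative to
  \<open>lam\<close>.\<close>

lemma response_skew:
  assumes [measurable]: "d \<in> borel_measurable M" "e \<in> borel_measurable N"
    and d: "\<And>x. x \<in> space M \<Longrightarrow> \<bar>d x\<bar> \<le> B" and e: "\<And>y. y \<in> space N \<Longrightarrow> \<bar>e y\<bar> \<le> B"
  shows "(\<integral>x. d x * response e x \<partial>M) = - (\<integral>y. e y * opponent.response d y \<partial>N)"
proof -
  interpret P: pair_prob_space M N ..
  have "integrable (M \<Otimes>\<^sub>M N) (\<lambda>(x, y). d x * (f (x, y) * e y))"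
  proof (rule P.integrable_bounded[of _ "B * (1 * B)"])
    show "\<bar>case z of (x, y) \<Rightarrow> d x * (f (x, y) * e y)\<bar> \<le> B * (1 * B)" if "z \<in> space (M \<Otimes>\<^sub>M N)" for z
    proof (cases z)
      case (Pair x y)
      have "\<bar>d x\<bar> * (\<bar>f (x, y)\<bar> * \<bar>e y\<bar>) \<le> B * (1 * B)"
        using that Pair d[of x] e[of y] f_bounded[of x y]
        by (intro mult_mono) (auto simp: space_pair_measure intro: order_trans[OF abs_ge_zero])
      thus ?thesis by (simp add: Pair abs_mult)
    qed
  qed measurable
  from P.Fubini_integral[OF this]
  have "(\<integral>y. (\<integral>x. d x * (f (x, y) * e y) \<partial>M) \<partial>N) = (\<integral>x. (\<integral>y. d x * (f (x, y) * e y) \<partial>N) \<partial>M)" .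
  moreover have "(\<integral>x. d x * (f (x, y) * e y) \<partial>M) = - (e y * opponent.response d y)" for y
  proof -
    have "(\<integral>x. d x * (f (x, y) * e y) \<partial>M) = (\<integral>x. e y * (f (x, y) * d x) \<partial>M)"
      by (simp add: mult_ac)
    thus ?thesis by (simp add: opponent.response_def)
  qed
  ultimately show ?thesis by (simp add: response_def)
qed

text \<open>The two equations are the first-order optimality conditions of the players, with
  \<open>\<alpha>\<close> and \<open>\<beta>\<close> as Lagrange multipliers for the total
  masses.\<close>

theorem entropic_equilibrium:
  assumes "0 < lam"
  obtains a b c C \<alpha> \<beta> where
    "0 < c" "bounded_density M c C a" "bounded_density N c C b"
    "\<forall>x\<in>space M. lam * ln (a x) + (\<integral>y. f (x, y) * b y \<partial>N) = \<alpha>"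
    "\<forall>y\<in>space N. lam * ln (b y) - (\<integral>x. f (x, y) * a x \<partial>M) = \<beta>"
proof -
  \<comment> \<open>For small \<open>eta\<close>, the step of either player preserves these bounds,
    and the constant density 1 lies between them.\<close>
  define C where "C = exp (2 / lam)"
  define c where "c = exp (- 4 * C / lam) / 2"
  \<comment> \<open>The first entry yields \<open>eta * lam \<le> c\<close>, as invariance and the
    pointwise contraction require. The second makes the quadratic error
    \<open>2 * eta\<^sup>2 * ((lam / c)\<^sup>2 + 1)\<close> at most half of the gain
    \<open>2 * eta * lam / C\<close>, which leaves the factor \<open>r\<close>.\<close>
  define eta where "eta = min (c / lam) (lam / (2 * C * ((lam / c)\<^sup>2 + 1)))"
  define r where "r = 1 - eta * lam / C"
  have "0 < c" by (simp add: c_def)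
  have "1 \<le> C" using \<open>0 < lam\<close> by (simp add: C_def)
  have "- 4 * C / lam \<le> 0" using \<open>1 \<le> C\<close> \<open>0 < lam\<close> by simp
  hence "exp (- 4 * C / lam) \<le> 1" by (simp only: exp_le_one_iff)
  hence "c < 1" unfolding c_def by linarith
  hence "c < C" using \<open>1 \<le> C\<close> by simp
  have pos: "0 < (lam / c)\<^sup>2 + 1" by (simp add: add_nonneg_pos)
  have "0 < eta" using pos \<open>0 < c\<close> \<open>1 \<le> C\<close> \<open>0 < lam\<close> by (simp add: eta_def)
  have "eta * lam \<le> c / lam * lam" using \<open>0 < lam\<close> by (intro mult_right_mono) (auto simp: eta_def)
  hence el: "eta * lam \<le> c" using \<open>0 < lam\<close> by simp
  have "0 < r" using el \<open>c < C\<close> \<open>0 < c\<close> by (simp add: r_def field_simps)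
  have "r < 1" using \<open>0 < eta\<close> \<open>0 < lam\<close> \<open>1 \<le> C\<close> by (simp add: r_def)
  have "eta * (2 * ((lam / c)\<^sup>2 + 1)) \<le> lam / (2 * C * ((lam / c)\<^sup>2 + 1)) * (2 * ((lam / c)\<^sup>2 + 1))"
    using pos by (intro mult_right_mono) (auto simp: eta_def)
  also have "\<dots> = lam / C" using pos \<open>1 \<le> C\<close> by (simp add: divide_simps)
  finally have "eta * (eta * (2 * ((lam / c)\<^sup>2 + 1))) \<le> eta * (lam / C)"
    using \<open>0 < eta\<close> by (intro mult_left_mono) auto
  hence eta2: "1 - 2 * eta * lam / C + 2 * eta\<^sup>2 * (lam / c)\<^sup>2 + 2 * eta\<^sup>2 \<le> r"
    by (simp add: r_def power2_eq_square algebra_simps)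

  \<comment> \<open>Both players move from the same old pair. An alternating update would put
    responses with shifted indices into the cross terms and spoil their cancellation.\<close>
  define z where "z n = ((\<lambda>(a, b). (entropic_step M lam eta (response b) a,
      entropic_step N lam eta (opponent.response a) b)) ^^ n) (\<lambda>_. 1, \<lambda>_. 1)" for n
  define a where "a n = fst (z n)" for n
  define b where "b n = snd (z n)" for n
  have rec: "a (Suc n) = entropic_step M lam eta (response (b n)) (a n)"
    "b (Suc n) = entropic_step N lam eta (opponent.response (a n)) (b n)" for n
    by (simp_all add: a_def b_def z_def split: prod.splits)
  have "bounded_density M c C (a n) \<and> bounded_density N c C (b n)" for n
  proof (induction n)
    case 0
    show ?case using \<open>c < 1\<close> \<open>1 \<le> C\<close>
      by (auto simp: a_def b_def z_def bounded_density_def M.prob_space N.prob_space)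
  next
    case (Suc n)
    show ?case unfolding rec
      using Suc \<open>0 < c\<close> \<open>0 < lam\<close> \<open>0 < eta\<close> el
      by (intro conjI M.bounded_density_step N.bounded_density_step)
         (auto simp: C_def c_def intro: response_measurable opponent.response_measurable
            bounded_density_measurable response_bounded opponent.response_bounded)
  qed
  hence a: "bounded_density M c C (a n)" and b: "bounded_density N c C (b n)" for n by auto
  have u: "response (b n) \<in> borel_measurable M" and v: "opponent.response (a n) \<in> borel_measurable N" for n
    using a b by (auto intro: response_measurable opponent.response_measurable bounded_density_measurable)
  have u1: "\<bar>response (b n) x\<bar> \<le> 1" if "x \<in> space M" for n x
    using response_bounded[OF b \<open>0 < c\<close> that] .
  have v1: "\<bar>opponent.response (a n) y\<bar> \<le> 1" if "y \<in> space N" for n y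
    using opponent.response_bounded[OF a \<open>0 < c\<close> that] .

  define A where "A n = (\<integral>x. (a (Suc n) x - a n x)\<^sup>2 \<partial>M)" for n
  define B where "B n = (\<integral>y. (b (Suc n) y - b n y)\<^sup>2 \<partial>N)" for n
  have nonneg: "0 \<le> A n" "0 \<le> B n" for n by (simp_all add: A_def B_def)
  have step: "A (Suc n) + B (Suc n) \<le> r * (A n + B n)" for n
  proof -
    \<comment> \<open>\<open>X\<close> and \<open>Y\<close> are the cross terms in the energy
      estimates of the two players; skewness gives \<open>X = - Y\<close>, so they vanish in the
      sum.\<close>
    define X where "X = (\<integral>x. (a (Suc n) x - a n x) * (response (b (Suc n)) x - response (b n) x) \<partial>M)"
    define Y where "Y = (\<integral>y. (b (Suc n) y - b n y) *
      (opponent.response (a (Suc n)) y - opponent.response (a n) y) \<partial>N)"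
    define k where "k = 1 - 2 * eta * lam / C + 2 * eta\<^sup>2 * (lam / c)\<^sup>2"
    have "X = (\<integral>x. (a (Suc n) x - a n x) * response (\<lambda>y. b (Suc n) y - b n y) x \<partial>M)"
      unfolding X_def using response_minus M.integrable_bounded_density[OF a] N.integrable_bounded_density[OF b]
      by (intro Bochner_Integration.integral_cong) auto
    also have "\<dots> = - (\<integral>y. (b (Suc n) y - b n y) * opponent.response (\<lambda>x. a (Suc n) x - a n x) y \<partial>N)"
      using M.bounded_density_diff[OF a a \<open>0 < c\<close>] N.bounded_density_diff[OF b b \<open>0 < c\<close>]
      by (intro response_skew[where B=C]) auto
    also have "(\<integral>y. (b (Suc n) y - b n y) * opponent.response (\<lambda>x. a (Suc n) x - a n x) y \<partial>N) = Y"
      unfolding Y_def using opponent.response_minus M.integrable_bounded_density[OF a]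
      by (intro Bochner_Integration.integral_cong) auto
    finally have XY: "X = - Y" .
    have "A (Suc n) \<le> k * A n - 2 * eta * X + 2 * eta\<^sup>2 * (\<integral>x. (response (b (Suc n)) x - response (b n) x)\<^sup>2 \<partial>M)"
      unfolding A_def X_def k_def rec(1)[of "Suc n"]
      using M.entropic_step_contraction[OF a a u u1 u u1 \<open>0 < lam\<close> _ \<open>0 < c\<close>] \<open>0 < eta\<close>
      by (subst (2) rec(1)) auto
    also have "\<dots> \<le> k * A n - 2 * eta * X + 2 * eta\<^sup>2 * B n"
      unfolding B_def using response_diff_energy[OF b b \<open>0 < c\<close>] by (intro add_left_mono mult_left_mono) auto
    finally have 1: "A (Suc n) \<le> k * A n - 2 * eta * X + 2 * eta\<^sup>2 * B n" .
    have "B (Suc n) \<le> k * B n - 2 * eta * Y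
        + 2 * eta\<^sup>2 * (\<integral>y. (opponent.response (a (Suc n)) y - opponent.response (a n) y)\<^sup>2 \<partial>N)"
      unfolding B_def Y_def k_def rec(2)[of "Suc n"]
      using N.entropic_step_contraction[OF b b v v1 v v1 \<open>0 < lam\<close> _ \<open>0 < c\<close>] \<open>0 < eta\<close>
      by (subst (2) rec(2)) auto
    also have "\<dots> \<le> k * B n - 2 * eta * Y + 2 * eta\<^sup>2 * A n"
      unfolding A_def using opponent.response_diff_energy[OF a a \<open>0 < c\<close>]
      by (intro add_left_mono mult_left_mono) auto
    finally have "A (Suc n) + B (Suc n) \<le> (k + 2 * eta\<^sup>2) * (A n + B n)"
      using 1 XY by (simp add: algebra_simps)
    also have "\<dots> \<le> r * (A n + B n)"
      using eta2 nonneg[of n] by (intro mult_right_mono) (auto simp: k_def)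
    finally show ?thesis .
  qed
  define K where "K = sqrt (A 0 + B 0)"
  have S: "sqrt (A n + B n) \<le> K * sqrt r ^ n" for n
  proof -
    have "A n + B n \<le> (A 0 + B 0) * r ^ n"
    proof (induction n)
      case (Suc n)
      have "r * (A n + B n) \<le> r * ((A 0 + B 0) * r ^ n)"
        using Suc \<open>0 < r\<close> by (intro mult_left_mono) auto
      thus ?case using step[of n] by (simp add: mult_ac)
    qed simp
    hence "sqrt (A n + B n) \<le> sqrt ((A 0 + B 0) * r ^ n)" by simp
    thus ?thesis by (simp add: K_def real_sqrt_mult real_sqrt_power)
  qed
  have SA: "sqrt (A n) \<le> K * sqrt r ^ n" and SB: "sqrt (B n) \<le> K * sqrt r ^ n" for n
    using nonneg[of n] by (auto intro!: order_trans[OF _ S[of n]])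
  have du: "\<bar>response (b (Suc n)) x - response (b n) x\<bar> \<le> K * sqrt r ^ n" if "x \<in> space M" for n x
    using order_trans[OF response_diff_sqrt[OF b b \<open>0 < c\<close> that] SB[unfolded B_def]] .
  have dv: "\<bar>opponent.response (a (Suc n)) y - opponent.response (a n) y\<bar> \<le> K * sqrt r ^ n" if "y \<in> space N" for n y
    using order_trans[OF opponent.response_diff_sqrt[OF a a \<open>0 < c\<close> that] SA[unfolded A_def]] .
  \<comment> \<open>Energies decay like \<open>r ^ n\<close>, so distances decay like
    \<open>sqrt r ^ n\<close>. This is strictly slower than the pointwise factor \<open>r\<close>,
    as the scalar recursion demands.\<close>
  have "r < sqrt r"
    using \<open>0 < r\<close> \<open>r < 1\<close> by (intro real_less_rsqrt) (simp add: power2_eq_square)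
  hence rs: "1 - eta * lam / C < sqrt r" by (simp add: r_def)
  have "sqrt r < 1" using \<open>r < 1\<close> by simp
  obtain p where p: "bounded_density M c C p" "\<forall>x\<in>space M. (\<lambda>n. a n x) \<longlonglongrightarrow> p x"
    "\<forall>v. (\<forall>x\<in>space M. (\<lambda>n. response (b n) x) \<longlonglongrightarrow> v x)
      \<longrightarrow> (\<exists>m. \<forall>x\<in>space M. lam * ln (p x) + v x = m)"
    using M.entropic_iteration_limit[OF a rec(1) u u1 \<open>0 < lam\<close> \<open>0 < eta\<close> \<open>0 < c\<close> el
      less_imp_le[OF \<open>c < C\<close>] du SA[unfolded A_def] rs \<open>sqrt r < 1\<close>] by blast
  obtain q where q: "bounded_density N c C q" "\<forall>y\<in>space N. (\<lambda>n. b n y) \<longlonglongrightarrow> q y"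
    "\<forall>v. (\<forall>y\<in>space N. (\<lambda>n. opponent.response (a n) y) \<longlonglongrightarrow> v y)
      \<longrightarrow> (\<exists>m. \<forall>y\<in>space N. lam * ln (q y) + v y = m)"
    using N.entropic_iteration_limit[OF b rec(2) v v1 \<open>0 < lam\<close> \<open>0 < eta\<close> \<open>0 < c\<close> el
      less_imp_le[OF \<open>c < C\<close>] dv SB[unfolded B_def] rs \<open>sqrt r < 1\<close>] by blast
  have fb: "\<bar>f (x, y) * t\<bar> \<le> C" if "c \<le> t" "t \<le> C" for x y t
  proof -
    have "\<bar>f (x, y)\<bar> * \<bar>t\<bar> \<le> 1 * C" using f_bounded[of x y] that \<open>0 < c\<close> by (intro mult_mono) auto
    thus ?thesis by (simp add: abs_mult)
  qed
  \<comment> \<open>With both limits at hand, the arbitrary limit potentials can be identified as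
    the responses to \<open>q\<close> and to \<open>p\<close>.\<close>
  have "(\<lambda>n. response (b n) x) \<longlonglongrightarrow> response q x" if [measurable]: "x \<in> space M" for x
    unfolding response_def
  proof (rule N.bounded_convergence(2)[where B=C])
    show "(\<lambda>y. f (x, y) * b n y) \<in> borel_measurable N" for n
      using bounded_density_measurable[OF b] by measurable
  qed (use fb bounded_density_bounds[OF b] in \<open>auto intro!: tendsto_mult q(2)[rule_format]\<close>)
  moreover have "(\<lambda>n. opponent.response (a n) y) \<longlonglongrightarrow> opponent.response p y" if [measurable]: "y \<in> space N" for y
    unfolding opponent.response_def
  proof (rule M.bounded_convergence(2)[where B=C])
    show "(\<lambda>x. (case (y, x) of (y, x) \<Rightarrow> - f (x, y)) * a n x) \<in> borel_measurable M" for n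
      using bounded_density_measurable[OF a] by measurable
  qed (use fb bounded_density_bounds[OF a] in \<open>auto intro!: tendsto_mult tendsto_minus p(2)[rule_format]\<close>)
  ultimately obtain \<alpha> \<beta> where "\<forall>x\<in>space M. lam * ln (p x) + response q x = \<alpha>"
    "\<forall>y\<in>space N. lam * ln (q y) + opponent.response p y = \<beta>"
    using p(3)[rule_format, of "response q"] q(3)[rule_format, of "opponent.response p"] by blast
  thus ?thesis
    by (intro that[of c C p q \<alpha> \<beta>] \<open>0 < c\<close> p(1) q(1)) (auto simp: response_def opponent.response_def)
qed

end

section \<open>Gaussian reference measures and the Gibbs variational principle\<close>

text \<open>For \<open>0 < t\<close> this is the centred Gaussian with variance
  \<open>1 / (2 * t)\<close> in each coordinate. The normalising constant stays an integral, so that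
  one formula serves all dimensions.\<close>

definition gaussian :: "real \<Rightarrow> 'a::euclidean_space measure" where
  "gaussian t = density lborel
     (\<lambda>x. ennreal (exp (- t * (norm x)\<^sup>2) / (\<integral>x. exp (- t * (norm (x::'a))\<^sup>2) \<partial>lborel)))"

lemma integrable_exp_neg_square:
  assumes "0 < t"
  shows "integrable lborel (\<lambda>x::real. exp (- t * x\<^sup>2))"
proof -
  define s where "s = 1 / sqrt (2 * t)"
  have s: "0 < s" "2 * s\<^sup>2 = 1 / t" using assms by (simp_all add: s_def power_divide)
  have "integrable lborel (\<lambda>x. sqrt (2 * pi * s\<^sup>2) * normal_density 0 s x)"
    using s by (intro integrable_mult_right integrable_normal_density)
  also have "(\<lambda>x. sqrt (2 * pi * s\<^sup>2) * normal_density 0 s x) = (\<lambda>x. exp (- t * x\<^sup>2))"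
    using s by (auto simp: normal_density_def mult.commute)
  finally show ?thesis .
qed

text \<open>The exponential of a sum of squared coordinates is a product of functions of one
  coordinate each, so the integral factorises into one-dimensional Gaussian integrals.\<close>

lemma integrable_exp_neg_norm_square:
  assumes "0 < t"
  shows "integrable lborel (\<lambda>x::'a::euclidean_space. exp (- t * (norm x)\<^sup>2))"
proof (rule integrableI_nonneg)
  have e: "exp (- t * (norm x)\<^sup>2) = (\<Prod>b\<in>Basis. exp (- t * (x \<bullet> b)\<^sup>2))" for x :: 'a
  proof -
    have "(norm x)\<^sup>2 = (\<Sum>b\<in>Basis. (x \<bullet> b)\<^sup>2)"
      unfolding power2_norm_eq_inner by (subst euclidean_inner) (simp add: power2_eq_square)
    thus ?thesis by (simp add: sum_distrib_left sum_negf flip: exp_sum)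
  qed
  have "(\<integral>\<^sup>+ x. ennreal (exp (- t * (norm (x::'a))\<^sup>2)) \<partial>lborel)
      = (\<integral>\<^sup>+ x. (\<Prod>b\<in>(Basis::'a set). ennreal (exp (- t * (x \<bullet> b)\<^sup>2))) \<partial>lborel)"
    unfolding e by (simp add: prod_ennreal)
  also have "\<dots> = (\<Prod>b\<in>(Basis::'a set). \<integral>\<^sup>+ x. ennreal (exp (- t * x\<^sup>2)) \<partial>lborel)"
    by (rule nn_integral_lborel_prod) auto
  also have "\<dots> = (\<Prod>b\<in>(Basis::'a set). ennreal (\<integral>x. exp (- t * x\<^sup>2) \<partial>lborel))"
    using integrable_exp_neg_square[OF assms] by (subst nn_integral_eq_integral) auto
  also have "\<dots> < \<infinity>" by (subst prod_ennreal) auto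
  finally show "(\<integral>\<^sup>+ x. ennreal (exp (- t * (norm (x::'a))\<^sup>2)) \<partial>lborel) < \<infinity>" .
qed auto

lemma gaussian_normalisation_pos:
  assumes "0 < t"
  shows "0 < (\<integral>x. exp (- t * (norm (x::'a::euclidean_space))\<^sup>2) \<partial>lborel)"
proof -
  have "(\<integral>x. exp (- t * (norm (x::'a))\<^sup>2) \<partial>lborel) \<noteq> 0"
  proof
    assume "(\<integral>x. exp (- t * (norm (x::'a))\<^sup>2) \<partial>lborel) = 0"
    hence "AE x::'a in lborel. exp (- t * (norm x)\<^sup>2) = 0"
      by (subst (asm) integral_nonneg_eq_0_iff_AE) (use integrable_exp_neg_norm_square[OF assms] in auto)
    hence "AE x::'a in lborel. False" by simp
    hence "emeasure lborel (UNIV :: 'a set) = 0" by (subst (asm) AE_iff_measurable[OF _ refl]) auto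
    thus False by simp
  qed
  moreover have "0 \<le> (\<integral>x. exp (- t * (norm (x::'a))\<^sup>2) \<partial>lborel)" by simp
  ultimately show ?thesis by linarith
qed

lemma sets_gaussian [simp, measurable_cong]: "sets (gaussian t) = sets borel"
  and space_gaussian [simp]: "space (gaussian t) = UNIV"
  by (simp_all add: gaussian_def)

lemma prob_space_gaussian:
  assumes "0 < t"
  shows "prob_space (gaussian t :: 'a::euclidean_space measure)"
proof
  let ?Z = "\<integral>x. exp (- t * (norm (x::'a))\<^sup>2) \<partial>lborel"
  have "emeasure (gaussian t :: 'a measure) (space (gaussian t)) = (\<integral>\<^sup>+ x. ennreal (exp (- t * (norm (x::'a))\<^sup>2) / ?Z) \<partial>lborel)"
    unfolding gaussian_def by (simp add: emeasure_density)
  also have "\<dots> = ennreal (\<integral>x. exp (- t * (norm (x::'a))\<^sup>2) / ?Z \<partial>lborel)"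
    using integrable_exp_neg_norm_square[OF assms] gaussian_normalisation_pos[OF assms, where 'a='a]
    by (intro nn_integral_eq_integral) auto
  also have "\<dots> = 1" using gaussian_normalisation_pos[OF assms, where 'a='a] by simp
  finally show "emeasure (gaussian t :: 'a measure) (space (gaussian t)) = 1" .
qed

section \<open>Extended expectations and densities of measures in \<open>P2\<close>\<close>

lemma ext_expectation_integrable:
  assumes "integrable p g"
  shows "ext_expectation p g = ereal (\<integral>x. g x \<partial>p)"
proof -
  obtain r q where "0 \<le> r" "0 \<le> q" "(\<integral>\<^sup>+ x. ennreal (g x) \<partial>p) = ennreal r"
    "(\<integral>\<^sup>+ x. ennreal (- g x) \<partial>p) = ennreal q" "(\<integral>x. g x \<partial>p) = r - q"
    using assms by (rule integrableE)
  thus ?thesis by (simp add: ext_expectation_def)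
qed

lemma ext_expectation_cong_AE:
  assumes "AE x in p. g x = h x"
  shows "ext_expectation p g = ext_expectation p h"
proof -
  have "(\<integral>\<^sup>+ x. ennreal (g x) \<partial>p) = (\<integral>\<^sup>+ x. ennreal (h x) \<partial>p)"
    "(\<integral>\<^sup>+ x. ennreal (- g x) \<partial>p) = (\<integral>\<^sup>+ x. ennreal (- h x) \<partial>p)"
    using assms by (auto intro!: nn_integral_cong_AE)
  thus ?thesis by (simp add: ext_expectation_def)
qed

text \<open>The integrable minorant \<open>h\<close> keeps the integral of the negative part of
  \<open>g\<close> finite, so only the positive part can diverge and no difference of infinities
  arises.\<close>

lemma ext_expectation_dichotomy:
  assumes "integrable p h" "AE x in p. h x \<le> g x" and [measurable]: "g \<in> borel_measurable p"
  shows "integrable p g \<or> ext_expectation p g = \<infinity>"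
proof (cases "(\<integral>\<^sup>+ x. ennreal (g x) \<partial>p) = \<infinity>")
  case True
  have "(\<integral>\<^sup>+ x. ennreal (- g x) \<partial>p) \<le> (\<integral>\<^sup>+ x. ennreal (norm (h x)) \<partial>p)"
    using assms(2) by (intro nn_integral_mono_AE) (auto intro!: ennreal_leI)
  also have "\<dots> < \<infinity>" using assms(1) by (simp add: integrable_iff_bounded)
  finally have "(\<integral>\<^sup>+ x. ennreal (- g x) \<partial>p) < \<infinity>" .
  hence "enn2ereal (\<integral>\<^sup>+ x. ennreal (- g x) \<partial>p) \<noteq> \<infinity>"
    by (metis enn2ereal_top enn2ereal_inject infinity_ennreal_def less_irrefl)
  thus ?thesis using True by (simp add: ext_expectation_def)
next
  case False
  have "(\<integral>\<^sup>+ x. ennreal (max 0 (g x)) \<partial>p) = (\<integral>\<^sup>+ x. ennreal (g x) \<partial>p)"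
    by (intro nn_integral_cong) (auto simp: max_def ennreal_neg)
  hence "integrable p (\<lambda>x. max 0 (g x))"
    using False by (intro integrableI_nonneg) (auto simp: less_top)
  hence "integrable p (\<lambda>x. max 0 (g x) + \<bar>h x\<bar>)" using assms(1) by simp
  hence "integrable p g"
    by (rule Bochner_Integration.integrable_bound) (use assms(2) in auto)
  thus ?thesis ..
qed

text \<open>Passes from the extended-valued Radon-Nikodym derivative to the real density inside
  \<open>regularizer\<close>: the derivative is finite almost everywhere by sigma-finiteness, and
  \<open>p\<close> does not charge the zero set of its own density.\<close>

lemma density_of_P2:
  fixes p :: "'a::euclidean_space measure"
  assumes "p \<in> P2"
  defines "\<rho> \<equiv> (\<lambda>x. enn2real (RN_deriv lborel p x))"
  shows "p = density lborel (\<lambda>x. ennreal (\<rho> x))" and "AE x in p. 0 < \<rho> x"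
proof -
  interpret p: prob_space p using assms by (simp add: P2_def)
  have p: "absolutely_continuous lborel p" "sets p = sets lborel" using assms by (auto simp: P2_def)
  have fin: "AE x in lborel. RN_deriv lborel p x \<noteq> \<infinity>"
    by (rule sigma_finite_measure.RN_deriv_finite[OF _ _ p])
       (auto intro: lborel.sigma_finite_measure_axioms p.sigma_finite_measure_axioms)
  have "p = density lborel (RN_deriv lborel p)" using sigma_finite_measure.density_RN_deriv[OF sigma_finite_lborel p] by simp
  also have "\<dots> = density lborel (\<lambda>x. ennreal (\<rho> x))"
  proof (rule density_cong)
    show "AE x in lborel. RN_deriv lborel p x = ennreal (\<rho> x)"
      using fin by eventually_elim (simp add: \<rho>_def less_top)
  qed (auto simp: \<rho>_def)
  finally show d: "p = density lborel (\<lambda>x. ennreal (\<rho> x))" .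
  have "AE x in density lborel (\<lambda>x. ennreal (\<rho> x)). 0 < \<rho> x"
    by (subst AE_density) (auto simp: \<rho>_def)
  thus "AE x in p. 0 < \<rho> x" unfolding d[symmetric] .
qed

text \<open>By \<open>eq\<close>, \<open>ps\<close> is the Gibbs measure of the potential
  \<open>lam1 * (norm x)\<^sup>2 + u x\<close> at temperature \<open>lam2\<close>. The free energy
  of \<open>p\<close> exceeds \<open>\<kappa>\<close> by \<open>lam2\<close> times the relative
  entropy of \<open>p\<close> with respect to \<open>ps\<close>, which is positive unless the
  measures agree.\<close>

lemma gibbs_variational_principle:
  fixes g u :: "'a::euclidean_space \<Rightarrow> real"
  assumes [measurable]: "g \<in> borel_measurable borel" "u \<in> borel_measurable borel"
    and g: "\<And>x. 0 < g x" and u: "\<And>x. \<bar>u x\<bar> \<le> B"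
    and ps: "ps = density lborel (\<lambda>x. ennreal (g x))" "ps \<in> P2"
    and eq: "\<And>x. lam1 * (norm x)\<^sup>2 + lam2 * ln (g x) + u x = \<kappa>"
    and "0 < lam2"
  shows "regularizer lam1 lam2 ps = ereal (\<kappa> - (\<integral>x. u x \<partial>ps))"
    and "p \<in> P2 \<Longrightarrow> p \<noteq> ps \<Longrightarrow> ereal \<kappa> < ereal (\<integral>x. u x \<partial>p) + regularizer lam1 lam2 p"
proof -
  interpret ps: prob_space ps using ps by (simp add: P2_def)
  have [measurable_cong]: "sets ps = sets borel" using ps by (simp add: P2_def)
  \<comment> \<open>Uniqueness of the derivative up to null sets allows the explicit
    \<open>g\<close> to replace the density chosen by \<open>RN_deriv\<close>.\<close>
  have "AE x in lborel. ennreal (g x) = RN_deriv lborel ps x"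
    by (rule sigma_finite_measure.RN_deriv_unique[OF sigma_finite_lborel]) (auto simp: ps(1))
  hence "AE x in ps. ennreal (g x) = RN_deriv lborel ps x"
    unfolding ps(1) by (subst AE_density) auto
  hence "AE x in ps. lam1 * (norm x)\<^sup>2 + lam2 * ln (enn2real (RN_deriv lborel ps x)) = \<kappa> - u x"
  proof eventually_elim
    case (elim x)
    have "enn2real (RN_deriv lborel ps x) = g x" using g[of x] by (simp flip: elim)
    thus ?case using eq[of x] by simp
  qed
  hence "regularizer lam1 lam2 ps = ext_expectation ps (\<lambda>x. \<kappa> - u x)"
    unfolding regularizer_def by (rule ext_expectation_cong_AE)
  also have "integrable ps u" using u by (intro ps.integrable_bounded[of _ B]) auto
  hence "ext_expectation ps (\<lambda>x. \<kappa> - u x) = ereal (\<kappa> - (\<integral>x. u x \<partial>ps))"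
    by (subst ext_expectation_integrable) (auto simp: ps.prob_space)
  finally show "regularizer lam1 lam2 ps = ereal (\<kappa> - (\<integral>x. u x \<partial>ps))" .

  assume p: "p \<in> P2" "p \<noteq> ps"
  interpret p: prob_space p using p by (simp add: P2_def)
  have sp [measurable_cong]: "sets p = sets borel" using p by (simp add: P2_def)
  define \<rho> where "\<rho> x = enn2real (RN_deriv lborel p x)" for x
  have \<rho>0: "0 \<le> \<rho> x" for x by (simp add: \<rho>_def)
  have [measurable]: "\<rho> \<in> borel_measurable borel"
    using borel_measurable_RN_deriv[of lborel p] unfolding \<rho>_def by measurable
  note d = density_of_P2(1)[OF p(1), folded \<rho>_def]
  note pos = density_of_P2(2)[OF p(1), folded \<rho>_def]
  have iu: "integrable p u" using u by (intro p.integrable_bounded[of _ B]) auto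
  have mass: "(\<integral>\<^sup>+ x. ennreal (\<rho> x) \<partial>lborel) = 1"
    using p.emeasure_space_1 by (subst (asm) (2) d, subst (asm) d) (simp add: emeasure_density)
  have mass_g: "(\<integral>\<^sup>+ x. ennreal (g x) \<partial>lborel) = 1"
    using ps.emeasure_space_1 by (simp add: ps(1) emeasure_density)
  have i\<rho>: "integrable lborel \<rho>" and ig: "integrable lborel g"
    using mass mass_g \<rho>0 less_imp_le[OF g] by (auto intro!: integrableI_nonneg)
  have "(\<integral>\<^sup>+ x. ennreal (g x / \<rho> x) \<partial>p) = (\<integral>\<^sup>+ x. ennreal (\<rho> x) * ennreal (g x / \<rho> x) \<partial>lborel)"
    by (subst d, subst nn_integral_density) auto
  \<comment> \<open>Only an inequality: where \<open>\<rho>\<close> vanishes, division by zero makes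
    the left integrand 0, and the mass of \<open>g\<close> there is lost.\<close>
  also have "\<dots> \<le> (\<integral>\<^sup>+ x. ennreal (g x) \<partial>lborel)"
    using \<rho>0 g by (intro nn_integral_mono) (auto simp: ennreal_mult'[symmetric] intro!: ennreal_leI less_imp_le)
  finally have le1: "(\<integral>\<^sup>+ x. ennreal (g x / \<rho> x) \<partial>p) \<le> 1" by (simp add: mass_g)
  have ratio0: "0 \<le> g x / \<rho> x" for x using \<rho>0[of x] g[of x] by simp
  have iq: "integrable p (\<lambda>x. g x / \<rho> x)"
    using le1 ratio0 by (intro integrableI_nonneg) (auto intro: le_less_trans)
  have "ennreal (\<integral>x. g x / \<rho> x \<partial>p) \<le> 1"
    using le1 nn_integral_eq_integral[OF iq] ratio0 by simp
  hence q1: "(\<integral>x. g x / \<rho> x \<partial>p) \<le> 1" by simp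
  define R where "R x = lam1 * (norm x)\<^sup>2 + lam2 * ln (\<rho> x)" for x
  \<comment> \<open>The minorant of \<open>R\<close> obtained from \<open>ln r \<le> r - 1\<close>
    at \<open>r = g x / \<rho> x\<close>. It is integrable even when \<open>R\<close> is not, and
    \<open>u + h\<close> has expectation at least \<open>\<kappa>\<close> because the ratio has
    expectation at most 1.\<close>
  define h where "h x = \<kappa> - u x + lam2 * (1 - g x / \<rho> x)" for x
  have R: "R x = \<kappa> - u x - lam2 * ln (g x / \<rho> x)" if "0 < \<rho> x" for x
    using eq[of x] g[of x] that by (simp add: R_def ln_div algebra_simps)
  have hR: "AE x in p. h x \<le> R x"
    using pos
  proof eventually_elim
    case (elim x)
    have "lam2 * ln (g x / \<rho> x) \<le> lam2 * (g x / \<rho> x - 1)"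
      using elim g[of x] \<open>0 < lam2\<close> by (intro mult_left_mono ln_le_minus_one) auto
    thus ?case by (simp add: R[OF elim] h_def algebra_simps)
  qed
  have ih: "integrable p h" unfolding h_def using iu iq by auto
  have [measurable]: "R \<in> borel_measurable p" unfolding R_def by measurable
  have reg: "regularizer lam1 lam2 p = ext_expectation p R"
    by (simp add: regularizer_def R_def[abs_def] \<rho>_def)
  show "ereal \<kappa> < ereal (\<integral>x. u x \<partial>p) + regularizer lam1 lam2 p"
  proof (cases "integrable p R")
    case False
    thus ?thesis using ext_expectation_dichotomy[OF ih hR] reg by simp
  next
    case True
    have h: "(\<integral>x. h x \<partial>p) = \<kappa> - (\<integral>x. u x \<partial>p) + lam2 * (1 - (\<integral>x. g x / \<rho> x \<partial>p))"
      unfolding h_def using iu iq by (simp add: p.prob_space)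
    have h_ge: "\<kappa> \<le> (\<integral>x. u x \<partial>p) + (\<integral>x. h x \<partial>p)"
      using q1 \<open>0 < lam2\<close> by (simp add: h)
    have Rh: "(\<integral>x. h x \<partial>p) \<le> (\<integral>x. R x \<partial>p)" using ih True hR by (rule integral_mono_AE)
    have "(\<integral>x. h x \<partial>p) \<noteq> (\<integral>x. R x \<partial>p)"
    proof
      assume "(\<integral>x. h x \<partial>p) = (\<integral>x. R x \<partial>p)"
      hence "(\<integral>x. R x - h x \<partial>p) = 0" using ih True by simp
      hence "AE x in p. R x - h x = 0"
        by (subst (asm) integral_nonneg_eq_0_iff_AE) (use ih True hR in auto)
      hence "AE x in p. \<rho> x = g x"
        using pos
      proof eventually_elim
        case (elim x)
        hence "lam2 * ln (g x / \<rho> x) = lam2 * (g x / \<rho> x - 1)"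
          by (simp add: R h_def algebra_simps)
        hence "ln (g x / \<rho> x) = g x / \<rho> x - 1" using \<open>0 < lam2\<close> by simp
        hence "g x / \<rho> x = 1" using elim g[of x] by (intro ln_eq_minus_one) auto
        thus ?case using elim by simp
      qed
      hence "AE x in lborel. 0 < \<rho> x \<longrightarrow> \<rho> x = g x"
        by (subst (asm) d, subst (asm) AE_density) auto
      \<comment> \<open>Equality was known only where \<open>\<rho>\<close> is positive; elsewhere
        \<open>\<rho> x = 0 < g x\<close>. So \<open>g - \<rho>\<close> is nonnegative almost
        everywhere, and as both functions have mass 1 they agree almost everywhere for Lebesgue
        measure.\<close>
      hence le: "AE x in lborel. 0 \<le> g x - \<rho> x"
        by eventually_elim (metis \<rho>0 g diff_ge_0_iff_ge less_eq_real_def)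
      have "(\<integral>x. g x - \<rho> x \<partial>lborel) = 0"
        using i\<rho> ig mass mass_g nn_integral_eq_integral[OF i\<rho>] nn_integral_eq_integral[OF ig] \<rho>0 less_imp_le[OF g]
        by simp
      hence "AE x in lborel. g x - \<rho> x = 0"
        by (subst (asm) integral_nonneg_eq_0_iff_AE) (use i\<rho> ig le in auto)
      hence "AE x in lborel. ennreal (\<rho> x) = ennreal (g x)" by eventually_elim simp
      hence "density lborel (\<lambda>x. ennreal (\<rho> x)) = density lborel (\<lambda>x. ennreal (g x))"
        by (intro density_cong) auto
      with d ps(1) p(2) show False by simp
    qed
    hence "\<kappa> < (\<integral>x. u x \<partial>p) + (\<integral>x. R x \<partial>p)" using Rh h_ge by linarith
    thus ?thesis by (simp add: reg ext_expectation_integrable[OF True])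
  qed
qed

text \<open>Translates an equation relative to the Gaussian into one relative to Lebesgue measure.
  The exponent \<open>lam1 / lam2\<close> makes the logarithm of the Gaussian weight, times
  \<open>lam2\<close>, cancel \<open>lam1 * (norm x)\<^sup>2\<close>; its normalisation merely
  shifts the constant \<open>\<alpha>\<close> by \<open>- lam2 * ln Z\<close>.\<close>

lemma gaussian_gibbs_density:
  fixes a u :: "'a::euclidean_space \<Rightarrow> real"
  assumes "0 < lam1" "0 < lam2" "0 < c"
    and a: "bounded_density (gaussian (lam1 / lam2)) c C a"
    and um [measurable]: "u \<in> borel_measurable borel" and u: "\<And>x. \<bar>u x\<bar> \<le> 1"
    and eq: "\<And>x. lam2 * ln (a x) + u x = \<alpha>"
  defines "ps \<equiv> density (gaussian (lam1 / lam2)) (\<lambda>x. ennreal (a x))"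
  shows "ps \<in> P2"
    and "\<exists>\<kappa>. regularizer lam1 lam2 ps = ereal (\<kappa> - (\<integral>x. u x \<partial>ps)) \<and>
           (\<forall>p\<in>P2. p \<noteq> ps \<longrightarrow> ereal \<kappa> < ereal (\<integral>x. u x \<partial>p) + regularizer lam1 lam2 p)"
proof -
  define t where "t = lam1 / lam2"
  have t: "0 < t" using assms by (simp add: t_def)
  define Z where "Z = (\<integral>x. exp (- t * (norm (x::'a))\<^sup>2) \<partial>lborel)"
  have Z: "0 < Z" unfolding Z_def by (rule gaussian_normalisation_pos[OF t])
  interpret G: prob_space "gaussian t :: 'a measure" by (rule prob_space_gaussian[OF t])
  note b = bounded_density_bounds[OF a, simplified]
  have am [measurable]: "a \<in> borel_measurable borel"
    using bounded_density_measurable[OF a] by (simp add: measurable_def)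
  define g where "g x = exp (- t * (norm x)\<^sup>2) / Z * a x" for x :: 'a
  have gm [measurable]: "g \<in> borel_measurable borel" unfolding g_def by measurable
  have g: "0 < g x" for x using Z \<open>0 < c\<close> b(1)[of x] by (simp add: g_def)
  have ps: "ps = density lborel (\<lambda>x. ennreal (g x))"
    unfolding ps_def gaussian_def t_def[symmetric] Z_def[symmetric] g_def using Z
    by (subst density_density_eq) (auto simp: ennreal_mult'[symmetric] intro!: density_cong)
  have ia: "integrable (gaussian t) a" using G.integrable_bounded_density a by (simp add: t_def)
  have "emeasure ps (space ps) = (\<integral>\<^sup>+ x. ennreal (a x) \<partial>gaussian t)"
    unfolding ps_def t_def by (simp add: emeasure_density)
  also have "\<dots> = ennreal (\<integral>x. a x \<partial>gaussian t)"
    using ia b \<open>0 < c\<close> by (intro nn_integral_eq_integral) (auto intro: order_trans[OF less_imp_le])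
  also have "\<dots> = 1" using a by (simp add: bounded_density_def t_def)
  finally have "prob_space ps" by (rule prob_spaceI)
  moreover have "sets ps = sets borel" by (simp add: ps)
  moreover have "absolutely_continuous lborel ps"
    unfolding ps by (intro absolutely_continuousI_density) auto
  moreover have "integrable ps (\<lambda>x. (norm x)\<^sup>2)"
  proof -
    \<comment> \<open>For the second moment, half of the Gaussian decay is spent on the quadratic
      factor, through \<open>r \<le> exp r\<close> with
      \<open>r = t / 2 * (norm x)\<^sup>2\<close>.\<close>
    have i: "integrable lborel (\<lambda>x::'a. C / Z * (2 / t) * exp (- (t / 2) * (norm x)\<^sup>2))"
      using t by (intro integrable_mult_right integrable_exp_neg_norm_square) auto
    have n: "norm (g x *\<^sub>R (norm x)\<^sup>2) \<le> norm (C / Z * (2 / t) * exp (- (t / 2) * (norm x)\<^sup>2))" for x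
    proof -
      have "t / 2 * (norm x)\<^sup>2 \<le> exp (t / 2 * (norm x)\<^sup>2)" using exp_ge_add_one_self[of "t / 2 * (norm x)\<^sup>2"] by linarith
      hence n: "(norm x)\<^sup>2 \<le> 2 / t * exp (t / 2 * (norm x)\<^sup>2)" using t by (simp add: field_simps)
      have "g x * (norm x)\<^sup>2 \<le> (exp (- t * (norm x)\<^sup>2) / Z * C) * (2 / t * exp (t / 2 * (norm x)\<^sup>2))"
        unfolding g_def using b[of x] Z \<open>0 < c\<close> n by (intro mult_mono mult_left_mono) auto
      also have "\<dots> = C / Z * (2 / t) * (exp (- t * (norm x)\<^sup>2) * exp (t / 2 * (norm x)\<^sup>2))" by simp
      also have "exp (- t * (norm x)\<^sup>2) * exp (t / 2 * (norm x)\<^sup>2) = exp (- (t / 2) * (norm x)\<^sup>2)"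
        unfolding exp_add[symmetric] by (simp add: field_simps)
      finally show ?thesis using g[of x] b[of x] Z t \<open>0 < c\<close> by simp
    qed
    have "integrable lborel (\<lambda>x. g x *\<^sub>R (norm x)\<^sup>2)"
      by (rule Bochner_Integration.integrable_bound[OF i _ AE_I2[OF n]]) measurable
    thus ?thesis
      unfolding ps using less_imp_le[OF g] by (subst integrable_density) auto
  qed
  ultimately show P2: "ps \<in> P2" by (simp add: P2_def)
  define \<kappa> where "\<kappa> = \<alpha> - lam2 * ln Z"
  have "lam1 * (norm x)\<^sup>2 + lam2 * ln (g x) + u x = \<kappa>" for x
  proof -
    have "0 < a x" using b(1)[of x] \<open>0 < c\<close> by simp
    hence lng: "ln (g x) = - t * (norm x)\<^sup>2 - ln Z + ln (a x)"
      using Z by (simp add: g_def ln_mult ln_div)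
    have "lam2 * ln (g x) = - (lam2 * t * (norm x)\<^sup>2) - lam2 * ln Z + lam2 * ln (a x)"
      unfolding lng by (simp add: algebra_simps)
    moreover have "lam2 * t = lam1" using \<open>0 < lam2\<close> by (simp add: t_def)
    ultimately show ?thesis using eq[of x] by (simp add: \<kappa>_def)
  qed
  from gibbs_variational_principle[OF gm um g u ps P2 this \<open>0 < lam2\<close>]
  show "\<exists>\<kappa>. regularizer lam1 lam2 ps = ereal (\<kappa> - (\<integral>x. u x \<partial>ps)) \<and>
           (\<forall>p\<in>P2. p \<noteq> ps \<longrightarrow> ereal \<kappa> < ereal (\<integral>x. u x \<partial>p) + regularizer lam1 lam2 p)"
    by blast
qed

section \<open>The mixed Nash equilibrium\<close>

theorem theorem6:
  fixes f :: "(real ^ 'm) \<times> (real ^ 'n) \<Rightarrow> real"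
    and grad_f :: "(real ^ 'm) \<times> (real ^ 'n) \<Rightarrow> (real ^ 'm) \<times> (real ^ 'n)"
    and L0 L1 lam1 lam2 :: real
  assumes gradient: "\<And>z. GDERIV f z :> grad_f z"
    and twice_differentiable: "\<And>z. grad_f differentiable (at z)"
    and A1: "L0-lipschitz_on UNIV f"
    and A2: "L1-lipschitz_on UNIV grad_f"
    and A3: "\<And>x y. \<bar>f (x, y)\<bar> \<le> 1"
    and "lam1 > 0" and "lam2 > 0"
  shows "\<exists>ps qs. mixed_nash f lam1 lam2 ps qs \<and>
           {p. is_arg_min (\<lambda>p. objective f lam1 lam2 p qs) (\<lambda>p. p \<in> P2) p} = {ps} \<and>
           {q. is_arg_max (\<lambda>q. objective f lam1 lam2 ps q) (\<lambda>q. q \<in> P2) q} = {qs}"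
proof -
  have lip: "continuous_on UNIV f" using A1 by (rule lipschitz_on_continuous_on)
  hence fm: "f \<in> borel_measurable borel" by (rule borel_measurable_continuous_onI)
  define t where "t = lam1 / lam2"
  have t: "0 < t" using \<open>lam1 > 0\<close> \<open>lam2 > 0\<close> by (simp add: t_def)
  define M :: "(real ^ 'm) measure" where "M = gaussian t"
  define N :: "(real ^ 'n) measure" where "N = gaussian t"
  have [measurable_cong]: "sets M = sets borel" "sets N = sets borel" by (simp_all add: M_def N_def)
  interpret M: prob_space M unfolding M_def by (rule prob_space_gaussian[OF t])
  interpret N: prob_space N unfolding N_def by (rule prob_space_gaussian[OF t])
  interpret bounded_game M N f
  proof
    have "sets (M \<Otimes>\<^sub>M N) = sets borel"
      unfolding borel_prod[symmetric] by (intro sets_pair_measure_cong) (simp_all add: M_def N_def)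
    from measurable_cong_sets[OF this refl] show "f \<in> borel_measurable (M \<Otimes>\<^sub>M N)" using fm by blast
  qed (rule A3)
  obtain a b c C \<alpha> \<beta> where "0 < c" and a: "bounded_density M c C a" and b: "bounded_density N c C b"
    and \<alpha>: "\<forall>x\<in>space M. lam2 * ln (a x) + (\<integral>y. f (x, y) * b y \<partial>N) = \<alpha>"
    and \<beta>: "\<forall>y\<in>space N. lam2 * ln (b y) - (\<integral>x. f (x, y) * a x \<partial>M) = \<beta>"
    by (rule entropic_equilibrium[OF \<open>lam2 > 0\<close>])
  define ps where "ps = density M (\<lambda>x. ennreal (a x))"
  define qs where "qs = density N (\<lambda>y. ennreal (b y))"
  define u where "u x = (\<integral>y. f (x, y) \<partial>qs)" for x
  define v where "v y = (\<integral>x. f (x, y) \<partial>ps)" for y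
  have u_eq: "u x = (\<integral>y. f (x, y) * b y \<partial>N)" for x
  proof -
    have "AE y in N. 0 \<le> b y" using bounded_density_bounds[OF b] \<open>0 < c\<close> by (intro AE_I2) (metis order_trans less_imp_le)
    moreover have "(\<lambda>y. f (x, y)) \<in> borel_measurable N" by (simp add: M_def)
    ultimately show ?thesis
      unfolding u_def qs_def using bounded_density_measurable[OF b]
      by (subst integral_density) (auto simp: mult.commute)
  qed
  have v_eq: "v y = (\<integral>x. f (x, y) * a x \<partial>M)" for y
  proof -
    have "AE x in M. 0 \<le> a x" using bounded_density_bounds[OF a] \<open>0 < c\<close> by (intro AE_I2) (metis order_trans less_imp_le)
    moreover have "(\<lambda>x. f (x, y)) \<in> borel_measurable M" by (simp add: N_def)
    ultimately show ?thesis
      unfolding v_def ps_def using bounded_density_measurable[OF a]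
      by (subst integral_density) (auto simp: mult.commute)
  qed
  interpret opponent: bounded_game N M "\<lambda>(y, x). - f (x, y)" by (rule opponent_game)
  have u: "u = response b" by (simp add: fun_eq_iff u_eq response_def)
  have v: "v = (\<lambda>y. - opponent.response a y)" by (simp add: fun_eq_iff v_eq opponent.response_def)
  have um: "u \<in> borel_measurable borel"
    using response_measurable[OF bounded_density_measurable[OF b]] unfolding u M_def by (simp add: measurable_def)
  have vm: "(\<lambda>y. - v y) \<in> borel_measurable borel"
    using opponent.response_measurable[OF bounded_density_measurable[OF a]] unfolding v N_def
    by (simp add: measurable_def)
  have u1: "\<bar>u x\<bar> \<le> 1" for x
    using response_bounded[OF b \<open>0 < c\<close>] by (simp add: u M_def)
  have v1: "\<bar>- v y\<bar> \<le> 1" for y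
    using opponent.response_bounded[OF a \<open>0 < c\<close>] by (simp add: v N_def)
  have eqs: "lam2 * ln (a x) + u x = \<alpha>" "lam2 * ln (b y) + - v y = \<beta>" for x y
    using \<alpha>[rule_format, of x] \<beta>[rule_format, of y] by (simp_all add: u_eq v_eq M_def N_def)
  \<comment> \<open>The same result serves both players, with potential \<open>u\<close> for the
    first and \<open>- v\<close> for the maximising second.\<close>
  note gp = gaussian_gibbs_density[OF \<open>lam1 > 0\<close> \<open>lam2 > 0\<close> \<open>0 < c\<close> a[unfolded M_def t_def] um u1 eqs(1),
      folded t_def, folded M_def, folded ps_def]
  note gq = gaussian_gibbs_density[OF \<open>lam1 > 0\<close> \<open>lam2 > 0\<close> \<open>0 < c\<close> b[unfolded N_def t_def] vm v1 eqs(2),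
      folded t_def, folded N_def, folded qs_def]
  obtain \<kappa> where rp: "regularizer lam1 lam2 ps = ereal (\<kappa> - (\<integral>x. u x \<partial>ps))"
    and \<kappa>: "\<And>p. p \<in> P2 \<Longrightarrow> p \<noteq> ps \<Longrightarrow> ereal \<kappa> < ereal (\<integral>x. u x \<partial>p) + regularizer lam1 lam2 p"
    using gp(2) by blast
  obtain \<kappa>' where rq: "regularizer lam1 lam2 qs = ereal (\<kappa>' - (\<integral>y. - v y \<partial>qs))"
    and \<kappa>': "\<And>q. q \<in> P2 \<Longrightarrow> q \<noteq> qs \<Longrightarrow> ereal \<kappa>' < ereal (\<integral>y. - v y \<partial>q) + regularizer lam1 lam2 q"
    using gq(2) by blast
  \<comment> \<open>\<open>objective\<close> has the integral over \<open>y\<close> inside, which is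
    the form \<open>\<integral>x. u x \<partial>p\<close> of the first player's problem. The second
    player's problem needs the opposite order, against every competitor \<open>q\<close>.\<close>
  have fubini: "(\<integral>x. (\<integral>y. f (x, y) \<partial>q) \<partial>ps) = (\<integral>y. v y \<partial>q)" if "q \<in> P2" for q
  proof -
    interpret P: pair_prob_space ps q
      using that gp(1) by (simp add: P2_def pair_prob_space_def pair_sigma_finite_def prob_space_imp_sigma_finite)
    have "sets (ps \<Otimes>\<^sub>M q) = sets borel"
      unfolding borel_prod[symmetric] using that gp(1) by (intro sets_pair_measure_cong) (simp_all add: P2_def)
    from measurable_cong_sets[OF this refl] have "f \<in> borel_measurable (ps \<Otimes>\<^sub>M q)" using fm by blast
    hence "integrable (ps \<Otimes>\<^sub>M q) f"
      using A3 by (intro P.integrable_bounded[of _ 1]) auto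
    hence "integrable (ps \<Otimes>\<^sub>M q) (\<lambda>(x, y). f (x, y))" by simp
    from P.Fubini_integral[OF this] show ?thesis by (simp add: v_def)
  qed
  \<comment> \<open>Payoff and regularizer of \<open>ps\<close> add up to exactly
    \<open>\<kappa>\<close>. By \<open>rp\<close> and \<open>rq\<close> both regularizers at the
    equilibrium are real, so only that of the deviating player can be infinite.\<close>
  have p_less: "objective f lam1 lam2 ps qs < objective f lam1 lam2 p qs" if "p \<in> P2" "p \<noteq> ps" for p
    using \<kappa>[OF that] unfolding objective_def u_def[symmetric]
    by (cases "regularizer lam1 lam2 p") (auto simp: rp rq)
  have q_less: "objective f lam1 lam2 ps q < objective f lam1 lam2 ps qs" if "q \<in> P2" "q \<noteq> qs" for q
    using \<kappa>'[OF that] unfolding objective_def fubini[OF that(1)] fubini[OF gq(1)]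
    by (cases "regularizer lam1 lam2 q") (auto simp: rp rq)
  have "mixed_nash f lam1 lam2 ps qs"
    unfolding mixed_nash_def using gp(1) gq(1) p_less q_less by (metis order.refl less_imp_le)
  moreover have "{p. is_arg_min (\<lambda>p. objective f lam1 lam2 p qs) (\<lambda>p. p \<in> P2) p} = {ps}"
    unfolding is_arg_min_def using gp(1) p_less by (auto dest: less_asym)
  moreover have "{q. is_arg_max (\<lambda>q. objective f lam1 lam2 ps q) (\<lambda>q. q \<in> P2) q} = {qs}"
    unfolding is_arg_max_def using gq(1) q_less by (auto dest: less_asym)
  ultimately show ?thesis by blast
qed

end
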